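(* Let $\mathcal A$ be an abelian category and let $\mathcal F$ be a class of objects of $\mathcal A$ which defines a homological dimension and is closed under finite direct sums. Let $0\to A\to B\to C\to 0$ be a short exact sequence in $\mathcal A$. Then for each $i\in\mathbb N$: $(1_i)$ if $B$ and $C$ belong to $\mathcal F_i$, then $A$ belongs to $\mathcal F_i$; $(2_i)$ if $A$ and $B$ belong to $\mathcal F_i$, then $C$ belongs to $\mathcal F_{i+1}$. If moreover $\overline{\mathcal F}$ is closed under extensions, then for each $i\in\mathbb N$: $(3_i)$ if $A$ and $C$ belong to $\mathcal F_{i+1}$, then $B$ belongs to $\mathcal F_{i+1}$; $(4_i)$ if $B\in\mathcal F_i$ and $C\in\mathcal F_{i+1}$, then $A$ belongs to $\mathcal F_i$.
   Context: Here $\mathbb N$ includes $0$. For $\alpha\in\mathbb N\cup\{\infty\}$, $\mathcal F_\alpha$ is the class of objects $M$ of $\mathcal A$ for which there is a long exact sequence $\cdots\to F_i\to F_{i-1}\to\cdots\to F_1\to F_0\to M\to 0$ with each $F_i\in\mathcal F\cup\{0\}$ and $F_i=0$ for $i>\alpha$. $\overline{\mathcal F}$ is the class of all objects of $\mathcal A$ which are homomorphic images (quotients) of objects in $\mathcal F$. The class $\mathcal F$ defines a homological dimension if: (1) for any short exact sequence $0\to K\to F\to M\to 0$ with $F\in\mathcal F$ and $M\in\mathcal F_\infty$, the object $K$ belongs to $\mathcal F_\infty$; and (2) for every $n\in\mathbb N$ and any exact sequence $0\to K_n\to F_{n-1}\to\cdots\to F_1\to F_0\to X\to 0$ with $F_i\in\mathcal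 F$ for $i=0,\dots,n-1$ and $X\in\mathcal F_n$, the object $K_n$ belongs to $\mathcal F$. *)

theory Defs
  imports "HOL-Algebra.FiniteProduct" "HOL-Library.Extended_Nat"
begin

record ('o, 'm) cat =
  Obj :: "'o set"
  Arr :: "'m set"
  Dom :: "'m \<Rightarrow> 'o"
  Cod :: "'m \<Rightarrow> 'o"
  ident :: "'o \<Rightarrow> 'm"
  cmp :: "'m \<Rightarrow> 'm \<Rightarrow> 'm"  (infixr "\<cdot>\<index>" 70)
  null :: "'o \<Rightarrow> 'o \<Rightarrow> 'm"
  add :: "'m \<Rightarrow> 'm \<Rightarrow> 'm"  (infixl "\<boxplus>\<index>" 65)

definition Hom :: "('o, 'm, 'z) cat_scheme \<Rightarrow> 'o \<Rightarrow> 'o \<Rightarrow> 'm set"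
  where "Hom C X Y = {f \<in> Arr C. Dom C f = X \<and> Cod C f = Y}"

text \<open>The group of arrows from \<open>X\<close> to \<open>Y\<close>, written multiplicatively as in the library:
  its operation is \<open>add\<close> and its unit is \<open>null X Y\<close>.\<close>

definition Hom_group :: "('o, 'm, 'z) cat_scheme \<Rightarrow> 'o \<Rightarrow> 'o \<Rightarrow> 'm monoid"
  where "Hom_group C X Y = \<lparr>carrier = Hom C X Y, mult = add C, one = null C X Y\<rparr>"

locale category =
  fixes C :: "('o, 'm, 'z) cat_scheme" (structure)
  assumes dom_in_Obj: "f \<in> Arr C \<Longrightarrow> Dom C f \<in> Obj C"
    and cod_in_Obj: "f \<in> Arr C \<Longrightarrow> Cod C f \<in> Obj C"
    and ident_in_Hom: "X \<in> Obj C \<Longrightarrow> ident C X \<in> Hom C X X"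
    and cmp_in_Hom: "f \<in> Hom C X Y \<Longrightarrow> g \<in> Hom C Y Z \<Longrightarrow> g \<cdot> f \<in> Hom C X Z"
    and cmp_ident: "f \<in> Hom C X Y \<Longrightarrow> f \<cdot> ident C X = f"
    and ident_cmp: "f \<in> Hom C X Y \<Longrightarrow> ident C Y \<cdot> f = f"
    and cmp_assoc: "f \<in> Hom C W X \<Longrightarrow> g \<in> Hom C X Y \<Longrightarrow> h \<in> Hom C Y Z \<Longrightarrow>
        (h \<cdot> g) \<cdot> f = h \<cdot> (g \<cdot> f)"

locale preadditive_category = category +
  assumes Hom_comm_group: "X \<in> Obj C \<Longrightarrow> Y \<in> Obj C \<Longrightarrow> comm_group (Hom_group C X Y)"
    and cmp_add: "f \<in> Hom C X Y \<Longrightarrow> g \<in> Hom C Y Z \<Longrightarrow> h \<in> Hom C Y Z \<Longrightarrow>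
        (g \<boxplus> h) \<cdot> f = (g \<cdot> f) \<boxplus> (h \<cdot> f)"
    and add_cmp: "f \<in> Hom C X Y \<Longrightarrow> g \<in> Hom C X Y \<Longrightarrow> h \<in> Hom C Y Z \<Longrightarrow>
        h \<cdot> (f \<boxplus> g) = (h \<cdot> f) \<boxplus> (h \<cdot> g)"

text \<open>\<open>S\<close> is the direct sum (biproduct) of \<open>G 0, \<dots>, G (n - 1)\<close>, with injections \<open>i\<close> and
  projections \<open>p\<close>; the \<open>finprod\<close> is the sum of the \<open>i k \<cdot> p k\<close> in the additive group of
  endomorphisms of \<open>S\<close>. For \<open>n = 0\<close> the last condition says that \<open>S\<close> is a zero object.\<close>

definition is_direct_sum ::
    "('o, 'm, 'z) cat_scheme \<Rightarrow> nat \<Rightarrow> (nat \<Rightarrow> 'o) \<Rightarrow> 'o \<Rightarrow> (nat \<Rightarrow> 'm) \<Rightarrow> (nat \<Rightarrow> 'm) \<Rightarrow> bool"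
  where "is_direct_sum C n G S i p \<longleftrightarrow>
    S \<in> Obj C \<and>
    (\<forall>k<n. i k \<in> Hom C (G k) S \<and> p k \<in> Hom C S (G k)) \<and>
    (\<forall>j<n. \<forall>k<n. p j \<cdot>\<^bsub>C\<^esub> i k = (if j = k then ident C (G k) else null C (G k) (G j))) \<and>
    finprod (Hom_group C S S) (\<lambda>k. i k \<cdot>\<^bsub>C\<^esub> p k) {..<n} = ident C S"

definition zero_object :: "('o, 'm, 'z) cat_scheme \<Rightarrow> 'o \<Rightarrow> bool"
  where "zero_object C Z \<longleftrightarrow> Z \<in> Obj C \<and>
    (\<forall>X \<in> Obj C. (\<exists>!f. f \<in> Hom C X Z) \<and> (\<exists>!f. f \<in> Hom C Z X))"

definition monic :: "('o, 'm, 'z) cat_scheme \<Rightarrow> 'm \<Rightarrow> bool"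
  where "monic C f \<longleftrightarrow> f \<in> Arr C \<and>
    (\<forall>X. \<forall>g \<in> Hom C X (Dom C f). \<forall>h \<in> Hom C X (Dom C f). f \<cdot>\<^bsub>C\<^esub> g = f \<cdot>\<^bsub>C\<^esub> h \<longrightarrow> g = h)"

definition epic :: "('o, 'm, 'z) cat_scheme \<Rightarrow> 'm \<Rightarrow> bool"
  where "epic C f \<longleftrightarrow> f \<in> Arr C \<and>
    (\<forall>X. \<forall>g \<in> Hom C (Cod C f) X. \<forall>h \<in> Hom C (Cod C f) X. g \<cdot>\<^bsub>C\<^esub> f = h \<cdot>\<^bsub>C\<^esub> f \<longrightarrow> g = h)"

definition is_kernel :: "('o, 'm, 'z) cat_scheme \<Rightarrow> 'm \<Rightarrow> 'm \<Rightarrow> bool"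
  where "is_kernel C k f \<longleftrightarrow>
    f \<in> Arr C \<and> k \<in> Arr C \<and> Cod C k = Dom C f \<and> f \<cdot>\<^bsub>C\<^esub> k = null C (Dom C k) (Cod C f) \<and>
    (\<forall>X. \<forall>h \<in> Hom C X (Dom C f). f \<cdot>\<^bsub>C\<^esub> h = null C X (Cod C f) \<longrightarrow>
      (\<exists>!u. u \<in> Hom C X (Dom C k) \<and> k \<cdot>\<^bsub>C\<^esub> u = h))"

definition is_cokernel :: "('o, 'm, 'z) cat_scheme \<Rightarrow> 'm \<Rightarrow> 'm \<Rightarrow> bool"
  where "is_cokernel C q f \<longleftrightarrow>
    f \<in> Arr C \<and> q \<in> Arr C \<and> Dom C q = Cod C f \<and> q \<cdot>\<^bsub>C\<^esub> f = null C (Dom C f) (Cod C q) \<and>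
    (\<forall>X. \<forall>h \<in> Hom C (Cod C f) X. h \<cdot>\<^bsub>C\<^esub> f = null C (Dom C f) X \<longrightarrow>
      (\<exists>!u. u \<in> Hom C (Cod C q) X \<and> u \<cdot>\<^bsub>C\<^esub> q = h))"

locale abelian_category = preadditive_category +
  assumes direct_sum_exists: "(\<And>k. k < n \<Longrightarrow> G k \<in> Obj C) \<Longrightarrow> \<exists>S i p. is_direct_sum C n G S i p"
    and kernel_exists: "f \<in> Arr C \<Longrightarrow> \<exists>k. is_kernel C k f"
    and cokernel_exists: "f \<in> Arr C \<Longrightarrow> \<exists>q. is_cokernel C q f"
    and monic_is_kernel: "monic C f \<Longrightarrow> \<exists>g. is_kernel C f g"
    and epic_is_cokernel: "epic C f \<Longrightarrow> \<exists>g. is_cokernel C f g"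

definition is_image :: "('o, 'm, 'z) cat_scheme \<Rightarrow> 'm \<Rightarrow> 'm \<Rightarrow> bool"
  where "is_image C m f \<longleftrightarrow> (\<exists>q. is_cokernel C q f \<and> is_kernel C m q)"

text \<open>The image of \<open>f\<close> is a kernel of \<open>g\<close>; composability \<open>Cod f = Dom g\<close> is implied,
  both being the codomain of \<open>m\<close>.\<close>

definition exact_at :: "('o, 'm, 'z) cat_scheme \<Rightarrow> 'm \<Rightarrow> 'm \<Rightarrow> bool"
  where "exact_at C f g \<longleftrightarrow> (\<exists>m. is_image C m f \<and> is_kernel C m g)"

text \<open>Arrows are listed in diagrammatic order.\<close>

definition exact_sequence :: "('o, 'm, 'z) cat_scheme \<Rightarrow> 'm list \<Rightarrow> bool"
  where "exact_sequence C fs \<longleftrightarrow> (\<forall>k. Suc k < length fs \<longrightarrow> exact_at C (fs ! k) (fs ! Suc k))"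

text \<open>A nonempty list of arrows that stays exact when a zero object is added at both ends.\<close>

definition exact_between_zeros :: "('o, 'm, 'z) cat_scheme \<Rightarrow> 'm list \<Rightarrow> bool"
  where "exact_between_zeros C fs \<longleftrightarrow> fs \<noteq> [] \<and>
    (\<exists>Z. zero_object C Z \<and>
      exact_sequence C (null C Z (Dom C (hd fs)) # fs @ [null C (Cod C (last fs)) Z]))"

definition short_exact :: "('o, 'm, 'z) cat_scheme \<Rightarrow> 'm \<Rightarrow> 'm \<Rightarrow> bool"
  where "short_exact C f g \<longleftrightarrow> exact_between_zeros C [f, g]"

text \<open>The class \<open>\<F>\<^sub>\<alpha>\<close>: \<open>G i\<close> is the \<open>i\<close>-th term of the resolution,
  \<open>d i\<close> its differential from \<open>G (i + 1)\<close> to \<open>G i\<close>, and \<open>e\<close> the augmentation.\<close>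

definition resolved_by :: "('o, 'm, 'z) cat_scheme \<Rightarrow> 'o set \<Rightarrow> enat \<Rightarrow> 'o set"
  where "resolved_by C \<F> \<alpha> = {M \<in> Obj C. \<exists>G d e Z.
    (\<forall>i. d i \<in> Hom C (G (Suc i)) (G i)) \<and> e \<in> Hom C (G 0) M \<and> zero_object C Z \<and>
    (\<forall>i. exact_at C (d (Suc i)) (d i)) \<and> exact_at C (d 0) e \<and> exact_at C e (null C M Z) \<and>
    (\<forall>i. G i \<in> \<F> \<or> zero_object C (G i)) \<and>
    (\<forall>i. enat i > \<alpha> \<longrightarrow> zero_object C (G i))}"

definition quotients_of :: "('o, 'm, 'z) cat_scheme \<Rightarrow> 'o set \<Rightarrow> 'o set"
  where "quotients_of C \<F> = {X \<in> Obj C. \<exists>F \<in> \<F>. \<exists>g \<in> Hom C F X. epic C g}"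

definition closed_under_extensions :: "('o, 'm, 'z) cat_scheme \<Rightarrow> 'o set \<Rightarrow> bool"
  where "closed_under_extensions C \<E> \<longleftrightarrow>
    (\<forall>f g. short_exact C f g \<and> Dom C f \<in> \<E> \<and> Cod C g \<in> \<E> \<longrightarrow> Cod C f \<in> \<E>)"

definition closed_under_finite_direct_sums :: "('o, 'm, 'z) cat_scheme \<Rightarrow> 'o set \<Rightarrow> bool"
  where "closed_under_finite_direct_sums C \<F> \<longleftrightarrow>
    (\<forall>n G S i p. (\<forall>k<n. G k \<in> \<F>) \<and> is_direct_sum C n G S i p \<longrightarrow> S \<in> \<F>)"

text \<open>In the second condition \<open>fs\<close> lists the \<open>n + 1\<close> arrows of
  \<open>K\<^sub>n \<rightarrow> F\<^sub>n\<^sub>-\<^sub>1 \<rightarrow> \<dots> \<rightarrow> F\<^sub>0 \<rightarrow> X\<close>, so the objects \<open>F\<^sub>n\<^sub>-\<^sub>1, \<dots>, F\<^sub>0\<close> are the codomains of all but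
  the last of them.\<close>

definition defines_homological_dimension :: "('o, 'm, 'z) cat_scheme \<Rightarrow> 'o set \<Rightarrow> bool"
  where "defines_homological_dimension C \<F> \<longleftrightarrow>
    (\<forall>f g. short_exact C f g \<and> Cod C f \<in> \<F> \<and> Cod C g \<in> resolved_by C \<F> \<infinity> \<longrightarrow>
      Dom C f \<in> resolved_by C \<F> \<infinity>) \<and>
    (\<forall>n fs. length fs = Suc n \<and> exact_between_zeros C fs \<and>
      (\<forall>f \<in> set (butlast fs). Cod C f \<in> \<F>) \<and>
      Cod C (last fs) \<in> resolved_by C \<F> (enat n) \<longrightarrow> Dom C (hd fs) \<in> \<F>)"

end

theory Submission imports Defs begin

text \<open>Write \<open>\<F>\<^sub>n\<close> for \<open>resolved_by C \<F> (enat n)\<close>. The theorem is dimension shifting along two facts about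
  a short exact sequence \<open>0 \<rightarrow> K \<rightarrow> P \<rightarrow> M \<rightarrow> 0\<close> with \<open>P \<in> \<F>\<close>: if \<open>K \<in> \<F>\<^sub>n\<close> then \<open>M \<in> \<F>\<^sub>n\<^sub>+\<^sub>1\<close>, by splicing
  (\<open>extension_resolved_by\<close>), and if \<open>M \<in> \<F>\<^sub>n\<^sub>+\<^sub>1\<close> then \<open>K \<in> \<F>\<^sub>n\<close> (\<open>syzygy_resolved_by\<close>). The second
  combines both conditions on \<open>\<F>\<close>: the first one allows \<open>K\<close> to be resolved indefinitely by objects
  of \<open>\<F>\<close>, and the second one, applied to the resulting resolution of \<open>M\<close>, says that the \<open>n\<close>-th
  syzygy of \<open>K\<close> already belongs to \<open>\<F>\<close>.

  Let \<open>0 \<rightarrow> A \<rightarrow> B \<rightarrow> C \<rightarrow> 0\<close> be exact. If \<open>P \<in> \<F>\<close> maps onto \<open>B\<close>, with kernel \<open>K\<close>, and \<open>L\<close> is the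
  kernel of the composite \<open>P \<rightarrow> C\<close>, then \<open>0 \<rightarrow> K \<rightarrow> L \<rightarrow> A \<rightarrow> 0\<close> is exact (\<open>extension_pullback\<close>). If in
  addition \<open>Q \<in> \<F>\<close> maps onto \<open>A\<close>, with kernel \<open>K'\<close>, and \<open>R\<close> is the kernel of the map \<open>P \<oplus> Q \<rightarrow> B\<close>, then
  \<open>0 \<rightarrow> K' \<rightarrow> R \<rightarrow> L \<rightarrow> 0\<close> is exact (\<open>extension_mapping_cone\<close>). Here \<open>K\<close>, \<open>R\<close>, \<open>K'\<close> and \<open>L\<close> are first
  syzygies of \<open>B\<close>, \<open>B\<close>, \<open>A\<close> and \<open>C\<close>, the second one because \<open>P \<oplus> Q \<in> \<F>\<close>, so each of them is in
  \<open>\<F>\<^sub>n\<close> if the corresponding object is in \<open>\<F>\<^sub>n\<^sub>+\<^sub>1\<close>.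

  Statement (2) follows by induction from the second sequence: if \<open>A\<close> and \<open>B\<close> belong to \<open>\<F>\<^sub>i\<^sub>+\<^sub>1\<close>, then
  \<open>K'\<close> and \<open>R\<close> belong to \<open>\<F>\<^sub>i\<close>, so \<open>L \<in> \<F>\<^sub>i\<^sub>+\<^sub>1\<close> and \<open>C \<in> \<F>\<^sub>i\<^sub>+\<^sub>2\<close>. The induction starts with
  \<open>A\<close> and \<open>B\<close> in \<open>\<F>\<^sub>0 = \<F>\<close>, where the given sequence is a resolution of \<open>C\<close>.

  Statement (4) is also proved by induction. If \<open>B \<in> \<F>\<^sub>i\<^sub>+\<^sub>1\<close> and \<open>C \<in> \<F>\<^sub>i\<^sub>+\<^sub>2\<close>, then \<open>K \<in> \<F>\<^sub>i\<close> and
  \<open>L \<in> \<F>\<^sub>i\<^sub>+\<^sub>1\<close>. Statement (2) for the first sequence yields only \<open>A \<in> \<F>\<^sub>i\<^sub>+\<^sub>2\<close>, one dimension too many, but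
  it provides an epimorphism \<open>Q \<rightarrow> A\<close> with \<open>Q \<in> \<F>\<close>. The second sequence has \<open>R \<in> \<F>\<^sub>i\<close> and
  \<open>L \<in> \<F>\<^sub>i\<^sub>+\<^sub>1\<close>, so \<open>K' \<in> \<F>\<^sub>i\<close> by induction, and therefore \<open>A \<in> \<F>\<^sub>i\<^sub>+\<^sub>1\<close>. The
  induction starts with \<open>B \<in> \<F>\<^sub>0 = \<F>\<close>, where \<open>A\<close> is a first syzygy of \<open>C \<in> \<F>\<^sub>1\<close>.

  Statement (1) follows from (4) because \<open>\<F>\<^sub>i\<close> is contained in \<open>\<F>\<^sub>i\<^sub>+\<^sub>1\<close>. For (3), closure under extensions makes
  \<open>B\<close> a quotient of some \<open>P \<in> \<F>\<close>; then \<open>L \<in> \<F>\<^sub>i\<close> and \<open>A \<in> \<F>\<^sub>i\<^sub>+\<^sub>1\<close>, so (4) for the first sequence gives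
  \<open>K \<in> \<F>\<^sub>i\<close>, that is, \<open>B \<in> \<F>\<^sub>i\<^sub>+\<^sub>1\<close>.

  The diagrams are chased with generalized elements: arrows into an object, which may be restricted
  along epimorphisms. The rules for this are \<open>epic_lift\<close> and \<open>exact_at_iff\<close>.\<close>

section \<open>Monomorphisms and epimorphisms\<close>

context category
begin

lemma HomI: "f \<in> Arr C \<Longrightarrow> Dom C f = X \<Longrightarrow> Cod C f = Y \<Longrightarrow> f \<in> Hom C X Y"
  by (simp add: Hom_def)

lemma HomD:
  assumes "f \<in> Hom C X Y"
  shows "f \<in> Arr C" "Dom C f = X" "Cod C f = Y"
  using assms by (simp_all add: Hom_def)

lemma Hom_objects:
  assumes "f \<in> Hom C X Y"
  shows "X \<in> Obj C" "Y \<in> Obj C"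
  using assms dom_in_Obj cod_in_Obj by (auto simp: Hom_def)

lemma monicI:
  assumes "f \<in> Hom C X Y"
    and "\<And>W g h. g \<in> Hom C W X \<Longrightarrow> h \<in> Hom C W X \<Longrightarrow> f \<cdot> g = f \<cdot> h \<Longrightarrow> g = h"
  shows "monic C f"
  using assms by (auto simp: monic_def Hom_def)

lemma monicD:
  assumes "monic C f" "f \<in> Hom C X Y" "g \<in> Hom C W X" "h \<in> Hom C W X" "f \<cdot> g = f \<cdot> h"
  shows "g = h"
  using assms by (fastforce simp: monic_def Hom_def)

lemma epicD:
  assumes "epic C f" "f \<in> Hom C X Y" "g \<in> Hom C Y Z" "h \<in> Hom C Y Z" "g \<cdot> f = h \<cdot> f"
  shows "g = h"
  using assms by (fastforce simp: epic_def Hom_def)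

lemma monic_cmp:
  assumes "monic C f" "f \<in> Hom C X Y" "monic C g" "g \<in> Hom C Y Z"
  shows "monic C (g \<cdot> f)"
proof (rule monicI)
  show "g \<cdot> f \<in> Hom C X Z" using assms cmp_in_Hom by blast
next
  fix W u v
  assume u: "u \<in> Hom C W X" and v: "v \<in> Hom C W X" and eq: "(g \<cdot> f) \<cdot> u = (g \<cdot> f) \<cdot> v"
  from eq have "g \<cdot> (f \<cdot> u) = g \<cdot> (f \<cdot> v)"
    using cmp_assoc[OF u assms(2,4)] cmp_assoc[OF v assms(2,4)] by simp
  then have "f \<cdot> u = f \<cdot> v"
    using monicD[OF assms(3,4)] cmp_in_Hom[OF u assms(2)] cmp_in_Hom[OF v assms(2)] by blast
  then show "u = v" using monicD[OF assms(1,2) u v] by blast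
qed

lemma epic_cmp:
  assumes "epic C f" "f \<in> Hom C X Y" "epic C g" "g \<in> Hom C Y Z"
  shows "epic C (g \<cdot> f)"
  unfolding epic_def
proof (intro conjI allI ballI impI)
  have gf: "g \<cdot> f \<in> Hom C X Z" using assms cmp_in_Hom by blast
  then show "g \<cdot> f \<in> Arr C" by (rule HomD)
  fix W u v
  assume "u \<in> Hom C (Cod C (g \<cdot> f)) W" "v \<in> Hom C (Cod C (g \<cdot> f)) W"
    and eq: "u \<cdot> (g \<cdot> f) = v \<cdot> (g \<cdot> f)"
  then have u: "u \<in> Hom C Z W" and v: "v \<in> Hom C Z W" using HomD[OF gf] by auto
  from eq have "(u \<cdot> g) \<cdot> f = (v \<cdot> g) \<cdot> f"
    using cmp_assoc[OF assms(2,4) u] cmp_assoc[OF assms(2,4) v] by simp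
  then have "u \<cdot> g = v \<cdot> g"
    using epicD[OF assms(1,2)] cmp_in_Hom[OF assms(4) u] cmp_in_Hom[OF assms(4) v] by blast
  then show "u = v" using epicD[OF assms(3,4) u v] by blast
qed

lemma epic_of_epic_cmp:
  assumes "epic C (g \<cdot> f)" "f \<in> Hom C X Y" "g \<in> Hom C Y Z"
  shows "epic C g"
  unfolding epic_def
proof (intro conjI allI ballI impI)
  show "g \<in> Arr C" using assms(3) by (rule HomD)
  fix W u v
  assume "u \<in> Hom C (Cod C g) W" "v \<in> Hom C (Cod C g) W" and eq: "u \<cdot> g = v \<cdot> g"
  then have u: "u \<in> Hom C Z W" and v: "v \<in> Hom C Z W" using HomD[OF assms(3)] by auto
  have "u \<cdot> (g \<cdot> f) = v \<cdot> (g \<cdot> f)"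
    using eq cmp_assoc[OF assms(2,3) u] cmp_assoc[OF assms(2,3) v] by simp
  then show "u = v" using epicD[OF assms(1) cmp_in_Hom[OF assms(2,3)] u v] by blast
qed

lemma monic_of_monic_cmp:
  assumes "monic C (g \<cdot> f)" "f \<in> Hom C X Y" "g \<in> Hom C Y Z"
  shows "monic C f"
proof (rule monicI[OF assms(2)])
  fix W u v
  assume u: "u \<in> Hom C W X" and v: "v \<in> Hom C W X" and eq: "f \<cdot> u = f \<cdot> v"
  have "(g \<cdot> f) \<cdot> u = (g \<cdot> f) \<cdot> v"
    using eq cmp_assoc[OF u assms(2,3)] cmp_assoc[OF v assms(2,3)] by simp
  then show "u = v" using monicD[OF assms(1) cmp_in_Hom[OF assms(2,3)] u v] by blast
qed

lemma ident_monic: "X \<in> Obj C \<Longrightarrow> monic C (ident C X)"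
  by (rule monicI[OF ident_in_Hom]) (auto simp: ident_cmp)

lemma ident_epic: "X \<in> Obj C \<Longrightarrow> epic C (ident C X)"
  using HomD[OF ident_in_Hom[of X]] cmp_ident by (auto simp: epic_def)

end

section \<open>Zero arrows, kernels and cokernels\<close>

context preadditive_category
begin

lemma null_in_Hom: "X \<in> Obj C \<Longrightarrow> Y \<in> Obj C \<Longrightarrow> null C X Y \<in> Hom C X Y"
  using monoid.one_closed[OF comm_group.axioms(1)[THEN comm_monoid.axioms(1), OF Hom_comm_group, of X Y]]
  by (simp add: Hom_group_def)

lemma add_in_Hom: "f \<in> Hom C X Y \<Longrightarrow> g \<in> Hom C X Y \<Longrightarrow> f \<boxplus> g \<in> Hom C X Y"
  using monoid.m_closed[OF comm_group.axioms(1)[THEN comm_monoid.axioms(1), OF Hom_comm_group, of X Y], of f g]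
    Hom_objects[of f X Y]
  by (simp add: Hom_group_def)

lemma null_add: "f \<in> Hom C X Y \<Longrightarrow> null C X Y \<boxplus> f = f"
  using monoid.l_one[OF comm_group.axioms(1)[THEN comm_monoid.axioms(1), OF Hom_comm_group, of X Y], of f]
    Hom_objects[of f X Y]
  by (simp add: Hom_group_def)

lemma add_null: "f \<in> Hom C X Y \<Longrightarrow> f \<boxplus> null C X Y = f"
  using monoid.r_one[OF comm_group.axioms(1)[THEN comm_monoid.axioms(1), OF Hom_comm_group, of X Y], of f]
    Hom_objects[of f X Y]
  by (simp add: Hom_group_def)

lemma add_right_cancel:
  assumes "f \<in> Hom C X Y" "g \<in> Hom C X Y" "h \<in> Hom C X Y" "f \<boxplus> h = g \<boxplus> h"
  shows "f = g"
proof -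
  interpret comm_group "Hom_group C X Y"
    using Hom_comm_group Hom_objects[OF assms(1)] .
  show ?thesis using right_cancel[of h f g] assms by (simp add: Hom_group_def)
qed

lemma negative_exists:
  assumes "f \<in> Hom C X Y"
  obtains f' where "f' \<in> Hom C X Y" "f \<boxplus> f' = null C X Y"
proof -
  interpret comm_group "Hom_group C X Y"
    using Hom_comm_group Hom_objects[OF assms(1)] .
  show ?thesis using that[of "inv\<^bsub>Hom_group C X Y\<^esub> f"] inv_closed[of f] r_inv[of f] assms by (simp add: Hom_group_def)
qed

lemma cmp_null:
  assumes "g \<in> Hom C Y Z" "X \<in> Obj C"
  shows "g \<cdot> null C X Y = null C X Z"
proof -
  have O: "Y \<in> Obj C" "Z \<in> Obj C" using Hom_objects[OF assms(1)] .
  have n: "null C X Y \<in> Hom C X Y" using null_in_Hom[OF assms(2) O(1)] .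
  have gn: "g \<cdot> null C X Y \<in> Hom C X Z" using cmp_in_Hom[OF n assms(1)] .
  have "(g \<cdot> null C X Y) \<boxplus> (g \<cdot> null C X Y) = null C X Z \<boxplus> (g \<cdot> null C X Y)"
    using add_cmp[OF n n assms(1)] null_add[OF n] null_add[OF gn] by simp
  then show ?thesis using add_right_cancel[OF gn null_in_Hom[OF assms(2) O(2)] gn] by simp
qed

lemma null_cmp:
  assumes "f \<in> Hom C X Y" "Z \<in> Obj C"
  shows "null C Y Z \<cdot> f = null C X Z"
proof -
  have O: "X \<in> Obj C" "Y \<in> Obj C" using Hom_objects[OF assms(1)] .
  have n: "null C Y Z \<in> Hom C Y Z" using null_in_Hom[OF O(2) assms(2)] .
  have nf: "null C Y Z \<cdot> f \<in> Hom C X Z" using cmp_in_Hom[OF assms(1) n] .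
  have "(null C Y Z \<cdot> f) \<boxplus> (null C Y Z \<cdot> f) = null C X Z \<boxplus> (null C Y Z \<cdot> f)"
    using cmp_add[OF assms(1) n n] null_add[OF n] null_add[OF nf] by simp
  then show ?thesis using add_right_cancel[OF nf null_in_Hom[OF O(1) assms(2)] nf] by simp
qed

text \<open>Since arrows can be subtracted, cancellability only has to be tested against zero.\<close>

lemma epicI_null:
  assumes f: "f \<in> Hom C X Y"
    and null: "\<And>Z g. g \<in> Hom C Y Z \<Longrightarrow> g \<cdot> f = null C X Z \<Longrightarrow> g = null C Y Z"
  shows "epic C f"
  unfolding epic_def
proof (intro conjI allI ballI impI)
  show "f \<in> Arr C" using f by (rule HomD)
  fix Z g h
  assume "g \<in> Hom C (Cod C f) Z" "h \<in> Hom C (Cod C f) Z" and eq: "g \<cdot> f = h \<cdot> f"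
  then have g: "g \<in> Hom C Y Z" and h: "h \<in> Hom C Y Z" using HomD[OF f] by auto
  obtain h' where h': "h' \<in> Hom C Y Z" "h \<boxplus> h' = null C Y Z" using negative_exists[OF h] .
  have "(g \<boxplus> h') \<cdot> f = (h \<boxplus> h') \<cdot> f"
    using cmp_add[OF f g h'(1)] cmp_add[OF f h h'(1)] eq by simp
  also have "\<dots> = null C X Z"
    using null_cmp[OF f] Hom_objects[OF g] h'(2) by simp
  finally have "g \<boxplus> h' = h \<boxplus> h'" using null[OF add_in_Hom[OF g h'(1)]] h'(2) by simp
  then show "g = h" using add_right_cancel[OF g h h'(1)] by simp
qed

lemma monic_null:
  assumes "monic C f" "f \<in> Hom C X Y" "g \<in> Hom C W X" "f \<cdot> g = null C W Y"
  shows "g = null C W X"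
  using monicD[OF assms(1-3) null_in_Hom] assms(4) cmp_null[OF assms(2)]
    Hom_objects[OF assms(2)] Hom_objects[OF assms(3)] by simp

lemma epic_null:
  assumes "epic C f" "f \<in> Hom C X Y" "g \<in> Hom C Y Z" "g \<cdot> f = null C X Z"
  shows "g = null C Y Z"
  using epicD[OF assms(1-3) null_in_Hom] assms(4) null_cmp[OF assms(2)]
    Hom_objects[OF assms(2)] Hom_objects[OF assms(3)] by simp

lemma monicI_null:
  assumes f: "f \<in> Hom C X Y"
    and null: "\<And>W g. g \<in> Hom C W X \<Longrightarrow> f \<cdot> g = null C W Y \<Longrightarrow> g = null C W X"
  shows "monic C f"
proof (rule monicI[OF f])
  fix W g h
  assume g: "g \<in> Hom C W X" and h: "h \<in> Hom C W X" and eq: "f \<cdot> g = f \<cdot> h"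
  obtain h' where h': "h' \<in> Hom C W X" "h \<boxplus> h' = null C W X" using negative_exists[OF h] .
  have "f \<cdot> (g \<boxplus> h') = f \<cdot> (h \<boxplus> h')"
    using add_cmp[OF g h'(1) f] add_cmp[OF h h'(1) f] eq by simp
  also have "\<dots> = null C W Y"
    using cmp_null[OF f] Hom_objects[OF g] h'(2) by simp
  finally have "g \<boxplus> h' = h \<boxplus> h'" using null[OF add_in_Hom[OF g h'(1)]] h'(2) by simp
  then show "g = h" using add_right_cancel[OF g h h'(1)] by simp
qed

lemma is_kernelD:
  assumes "is_kernel C k f" "f \<in> Hom C X Y"
  shows "k \<in> Hom C (Dom C k) X" "f \<cdot> k = null C (Dom C k) Y"
    and "\<And>W h. h \<in> Hom C W X \<Longrightarrow> f \<cdot> h = null C W Y \<Longrightarrow> \<exists>u. u \<in> Hom C W (Dom C k) \<and> k \<cdot> u = h"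
  using assms(1) unfolding is_kernel_def HomD[OF assms(2)] by (simp_all add: HomI) metis

lemma is_kernel_monic:
  assumes "is_kernel C k f"
  shows "monic C k"
proof -
  define X where "X = Dom C f"
  define Y where "Y = Cod C f"
  have f: "f \<in> Hom C X Y" using assms by (auto simp: is_kernel_def X_def Y_def Hom_def)
  note k = is_kernelD[OF assms f]
  show ?thesis
  proof (rule monicI[OF k(1)])
    fix W g h
    assume g: "g \<in> Hom C W (Dom C k)" and h: "h \<in> Hom C W (Dom C k)" and eq: "k \<cdot> g = k \<cdot> h"
    have "f \<cdot> (k \<cdot> g) = null C W Y"
      using cmp_assoc[OF g k(1) f] null_cmp[OF g] k(2) Hom_objects[OF f] by simp
    then have "\<exists>!u. u \<in> Hom C W (Dom C k) \<and> k \<cdot> u = k \<cdot> g"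
      using assms cmp_in_Hom[OF g k(1)] by (auto simp: is_kernel_def X_def Y_def)
    then show "g = h" using g h eq by metis
  qed
qed

lemma is_kernelI:
  assumes f: "f \<in> Hom C X Y" and k: "k \<in> Hom C K X" and "monic C k" "f \<cdot> k = null C K Y"
    and fac: "\<And>W h. h \<in> Hom C W X \<Longrightarrow> f \<cdot> h = null C W Y \<Longrightarrow> \<exists>u. u \<in> Hom C W K \<and> k \<cdot> u = h"
  shows "is_kernel C k f"
  unfolding is_kernel_def HomD[OF f] HomD[OF k]
proof (intro conjI allI ballI impI)
  fix W h assume "h \<in> Hom C W X" "f \<cdot> h = null C W Y"
  then obtain u where u: "u \<in> Hom C W K" "k \<cdot> u = h" using fac by blast
  show "\<exists>!u. u \<in> Hom C W K \<and> k \<cdot> u = h"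
    using u monicD[OF assms(3) k] by (intro ex1I[of _ u]) auto
qed (use HomD[OF f] HomD[OF k] assms(4) in auto)

lemma is_cokernelD:
  assumes "is_cokernel C q f" "f \<in> Hom C X Y"
  shows "q \<in> Hom C Y (Cod C q)" "q \<cdot> f = null C X (Cod C q)"
    and "\<And>W h. h \<in> Hom C Y W \<Longrightarrow> h \<cdot> f = null C X W \<Longrightarrow> \<exists>u. u \<in> Hom C (Cod C q) W \<and> u \<cdot> q = h"
  using assms(1) unfolding is_cokernel_def HomD[OF assms(2)] by (simp_all add: HomI) metis

lemma zero_object_Hom:
  assumes "zero_object C Z" "f \<in> Hom C X Z"
  shows "f = null C X Z"
  using assms null_in_Hom Hom_objects[OF assms(2)] unfolding zero_object_def by metis

lemma zero_objectI:
  assumes "S \<in> Obj C" "ident C S = null C S S"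
  shows "zero_object C S"
  unfolding zero_object_def
proof (intro conjI ballI)
  fix X assume X: "X \<in> Obj C"
  show "\<exists>!f. f \<in> Hom C X S"
  proof (rule ex1I[of _ "null C X S"])
    fix f assume f: "f \<in> Hom C X S"
    have "f = null C S S \<cdot> f" using ident_cmp[OF f] assms(2) by simp
    then show "f = null C X S" using null_cmp[OF f assms(1)] by simp
  qed (rule null_in_Hom[OF X assms(1)])
  show "\<exists>!f. f \<in> Hom C S X"
  proof (rule ex1I[of _ "null C S X"])
    fix f assume f: "f \<in> Hom C S X"
    have "f = f \<cdot> null C S S" using cmp_ident[OF f] assms(2) by simp
    then show "f = null C S X" using cmp_null[OF f assms(1)] by simp
  qed (rule null_in_Hom[OF assms(1) X])
qed (fact assms)

end


section \<open>Exactness in terms of elements\<close>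

context abelian_category
begin

lemma zero_object_exists:
  obtains Z where "zero_object C Z"
proof -
  obtain S :: 'a and i p where S: "is_direct_sum C 0 (\<lambda>_. undefined) S i p"
    using direct_sum_exists[of 0 "\<lambda>_. undefined"] by auto
  then have "S \<in> Obj C" by (simp add: is_direct_sum_def)
  then interpret comm_group "Hom_group C S S" using Hom_comm_group by blast
  have "ident C S = one (Hom_group C S S)"
    using S by (simp add: is_direct_sum_def)
  then have "ident C S = null C S S" by (simp add: Hom_group_def)
  with \<open>S \<in> Obj C\<close> show ?thesis using that zero_objectI by blast
qed

lemma zero_object_is_direct_sum:
  assumes "zero_object C Z"
  shows "is_direct_sum C 0 G Z i p"
proof -
  have Z: "Z \<in> Obj C" using assms by (simp add: zero_object_def)
  interpret comm_group "Hom_group C Z Z" using Hom_comm_group Z by blast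
  have "ident C Z = one (Hom_group C Z Z)"
    using zero_object_Hom[OF assms ident_in_Hom[OF Z]] by (simp add: Hom_group_def)
  then show ?thesis using Z by (simp add: is_direct_sum_def)
qed


text \<open>The arrow \<open>d\<close> is the map \<open>(p, - h)\<close> from \<open>S = P \<oplus> Q\<close> to \<open>B\<close>. Its kernel is the pullback of
  \<open>p\<close> and \<open>h\<close>, and it is as surjective as \<open>p\<close>, which is its restriction to \<open>P\<close>. The clauses present
  \<open>S\<close> by its generalized elements, the pairs of an element of \<open>P\<close> and an element of \<open>Q\<close>.\<close>

lemma difference_map:
  assumes p: "p \<in> Hom C P B" and h: "h \<in> Hom C Q B"
  obtains S p1 p2 d where "p1 \<in> Hom C S P" "p2 \<in> Hom C S Q" "d \<in> Hom C S B"
    and "\<forall>W. \<forall>x \<in> Hom C W S. d \<cdot> x = null C W B \<longleftrightarrow> p \<cdot> (p1 \<cdot> x) = h \<cdot> (p2 \<cdot> x)"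
    and "\<forall>W. \<forall>x \<in> Hom C W P. \<forall>y \<in> Hom C W Q. \<exists>z \<in> Hom C W S. p1 \<cdot> z = x \<and> p2 \<cdot> z = y"
    and "\<forall>W. \<forall>z \<in> Hom C W S. \<forall>z' \<in> Hom C W S. p1 \<cdot> z = p1 \<cdot> z' \<longrightarrow> p2 \<cdot> z = p2 \<cdot> z' \<longrightarrow> z = z'"
    and "\<exists>i \<in> Hom C P S. d \<cdot> i = p \<and> p2 \<cdot> i = null C P Q"
    and "epic C p2"
    and "\<forall>\<F>. closed_under_finite_direct_sums C \<F> \<longrightarrow> P \<in> \<F> \<longrightarrow> Q \<in> \<F> \<longrightarrow> S \<in> \<F>"
proof -
  have P: "P \<in> Obj C" and Q: "Q \<in> Obj C" and B: "B \<in> Obj C"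
    using Hom_objects[OF p] Hom_objects[OF h] by blast+
  define G where "G k = (if k = 0 then P else Q)" for k :: nat
  obtain S i \<pi> where S: "is_direct_sum C 2 G S i \<pi>"
    using direct_sum_exists[of 2 G] P Q unfolding G_def by metis
  define i1 where "i1 = i 0"
  define i2 where "i2 = i 1"
  define p1 where "p1 = \<pi> 0"
  define p2 where "p2 = \<pi> 1"
  have SO: "S \<in> Obj C" using S by (simp add: is_direct_sum_def)
  have two: "(0::nat) < 2" "(1::nat) < 2" by simp_all
  have homs: "\<And>k. k < 2 \<Longrightarrow> i k \<in> Hom C (G k) S \<and> \<pi> k \<in> Hom C S (G k)"
    and comps: "\<And>j k. j < 2 \<Longrightarrow> k < 2 \<Longrightarrow>
        \<pi> j \<cdot> i k = (if j = k then ident C (G k) else null C (G k) (G j))"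
    and total: "finprod (Hom_group C S S) (\<lambda>k. i k \<cdot> \<pi> k) {..<2} = ident C S"
    using S by (simp_all add: is_direct_sum_def)
  have i1: "i1 \<in> Hom C P S" and i2: "i2 \<in> Hom C Q S"
    and p1: "p1 \<in> Hom C S P" and p2: "p2 \<in> Hom C S Q"
    using homs[OF two(1)] homs[OF two(2)] by (simp_all add: G_def i1_def i2_def p1_def p2_def)
  have c: "p1 \<cdot> i1 = ident C P" "p2 \<cdot> i2 = ident C Q" "p1 \<cdot> i2 = null C Q P" "p2 \<cdot> i1 = null C P Q"
    using comps[OF two(1,1)] comps[OF two(2,2)] comps[OF two(1,2)] comps[OF two(2,1)]
    by (simp_all add: G_def i1_def i2_def p1_def p2_def)
  have ip: "i1 \<cdot> p1 \<in> Hom C S S" "i2 \<cdot> p2 \<in> Hom C S S"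
    using cmp_in_Hom[OF p1 i1] cmp_in_Hom[OF p2 i2] by blast+
  interpret H: comm_group "Hom_group C S S" using Hom_comm_group SO by blast
  have sum: "(i1 \<cdot> p1) \<boxplus> (i2 \<cdot> p2) = ident C S"
  proof -
    have "{..<2::nat} = insert 0 (insert 1 {})" by auto
    moreover have "finprod (Hom_group C S S) (\<lambda>k. i k \<cdot> \<pi> k) (insert 0 (insert 1 {})) = (i1 \<cdot> p1) \<boxplus> (i2 \<cdot> p2)"
      using ip add_null[OF ip(2)]
      using H.finprod_insert[of "{1}" 0 "\<lambda>k. i k \<cdot> \<pi> k"] H.finprod_insert[of "{}" 1 "\<lambda>k. i k \<cdot> \<pi> k"]
      by (simp add: Hom_group_def i1_def i2_def p1_def p2_def Pi_def H.finprod_empty[unfolded Hom_group_def])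
    ultimately show ?thesis using total by simp
  qed
  obtain h' where h': "h' \<in> Hom C Q B" "h \<boxplus> h' = null C Q B" using negative_exists[OF h] .
  have pp1: "p \<cdot> p1 \<in> Hom C S B" and hp2: "h' \<cdot> p2 \<in> Hom C S B"
    using cmp_in_Hom[OF p1 p] cmp_in_Hom[OF p2 h'(1)] by blast+
  define d where "d = (p \<cdot> p1) \<boxplus> (h' \<cdot> p2)"
  have d: "d \<in> Hom C S B" using add_in_Hom[OF pp1 hp2] by (simp add: d_def)
  have dx: "d \<cdot> x = (p \<cdot> (p1 \<cdot> x)) \<boxplus> (h' \<cdot> (p2 \<cdot> x))" if x: "x \<in> Hom C W S" for W x
    using cmp_add[OF x pp1 hp2] cmp_assoc[OF x p1 p] cmp_assoc[OF x p2 h'(1)] by (simp add: d_def)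
  have recon: "(i1 \<cdot> (p1 \<cdot> z)) \<boxplus> (i2 \<cdot> (p2 \<cdot> z)) = z" if z: "z \<in> Hom C W S" for W z
    using cmp_add[OF z ip] ident_cmp[OF z] cmp_assoc[OF z p1 i1] cmp_assoc[OF z p2 i2] sum by simp
  show ?thesis
  proof (rule that[OF p1 p2 d]; (intro allI ballI impI)?)
    fix W x assume x: "x \<in> Hom C W S"
    have ax: "p \<cdot> (p1 \<cdot> x) \<in> Hom C W B" and bx: "h \<cdot> (p2 \<cdot> x) \<in> Hom C W B"
      and bx': "h' \<cdot> (p2 \<cdot> x) \<in> Hom C W B" and yx: "p2 \<cdot> x \<in> Hom C W Q"
      using cmp_in_Hom x p1 p2 p h h'(1) by blast+
    have "(h \<cdot> (p2 \<cdot> x)) \<boxplus> (h' \<cdot> (p2 \<cdot> x)) = null C W B"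
      using cmp_add[OF yx h h'(1)] h'(2) null_cmp[OF yx B] by simp
    then show "d \<cdot> x = null C W B \<longleftrightarrow> p \<cdot> (p1 \<cdot> x) = h \<cdot> (p2 \<cdot> x)"
      unfolding dx[OF x] using add_right_cancel[OF ax bx bx'] by metis
  next
    fix W x y assume x: "x \<in> Hom C W P" and y: "y \<in> Hom C W Q"
    have ix: "i1 \<cdot> x \<in> Hom C W S" and iy: "i2 \<cdot> y \<in> Hom C W S"
      using cmp_in_Hom x y i1 i2 by blast+
    let ?z = "(i1 \<cdot> x) \<boxplus> (i2 \<cdot> y)"
    have "p1 \<cdot> (i1 \<cdot> x) = x" "p1 \<cdot> (i2 \<cdot> y) = null C W P" "p2 \<cdot> (i1 \<cdot> x) = null C W Q" "p2 \<cdot> (i2 \<cdot> y) = y"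
      using cmp_assoc[OF x i1 p1] cmp_assoc[OF x i1 p2] cmp_assoc[OF y i2 p1] cmp_assoc[OF y i2 p2]
        c ident_cmp[OF x] ident_cmp[OF y] null_cmp[OF x Q] null_cmp[OF y P] by simp_all
    then have "p1 \<cdot> ?z = x" "p2 \<cdot> ?z = y"
      using add_cmp[OF ix iy p1] add_cmp[OF ix iy p2] add_null[OF x] null_add[OF y] by simp_all
    then show "\<exists>z \<in> Hom C W S. p1 \<cdot> z = x \<and> p2 \<cdot> z = y" using add_in_Hom[OF ix iy] by blast
  next
    fix W z z' assume "z \<in> Hom C W S" "z' \<in> Hom C W S" "p1 \<cdot> z = p1 \<cdot> z'" "p2 \<cdot> z = p2 \<cdot> z'"
    then show "z = z'" using recon by metis
  next
    have "d \<cdot> i1 = (p \<cdot> ident C P) \<boxplus> (h' \<cdot> null C P Q)" using dx[OF i1] c by simp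
    then have "d \<cdot> i1 = p" using cmp_ident[OF p] cmp_null[OF h'(1) P] add_null[OF p] by simp
    then show "\<exists>i \<in> Hom C P S. d \<cdot> i = p \<and> p2 \<cdot> i = null C P Q" using i1 c by blast
  next
    show "epic C p2" using epic_of_epic_cmp[OF _ i2 p2] ident_epic[OF Q] c by simp
  next
    fix \<F> assume "closed_under_finite_direct_sums C \<F>" "P \<in> \<F>" "Q \<in> \<F>"
    moreover from this have "\<forall>k<2. G k \<in> \<F>" by (simp add: G_def)
    ultimately show "S \<in> \<F>" using S unfolding closed_under_finite_direct_sums_def by blast
  qed
qed

lemma kernel_obtain:
  assumes "f \<in> Hom C X Y"
  obtains K k where "k \<in> Hom C K X" "is_kernel C k f"
  using kernel_exists[OF HomD(1)[OF assms]] is_kernelD(1)[OF _ assms] by blast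

text \<open>An epimorphism is the cokernel of some arrow; that arrow factors through the kernel of the
  epimorphism, so the epimorphism is also the cokernel of its own kernel.\<close>

lemma epic_factor:
  assumes "epic C e" and e: "e \<in> Hom C X Y" and r: "r \<in> Hom C X Z"
    and "is_kernel C k e" and "r \<cdot> k = null C (Dom C k) Z"
  obtains s where "s \<in> Hom C Y Z" "s \<cdot> e = r"
proof -
  obtain g where g: "is_cokernel C e g" using epic_is_cokernel[OF assms(1)] by blast
  then have "g \<in> Arr C" "Dom C e = Cod C g" by (simp_all add: is_cokernel_def)
  then have gH: "g \<in> Hom C (Dom C g) X" using HomD[OF e] by (simp add: Hom_def)
  note k = is_kernelD[OF assms(4) e]
  note q = is_cokernelD[OF g gH]
  have "e \<cdot> g = null C (Dom C g) Y" using q(2) HomD[OF e] by simp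
  then obtain u where u: "u \<in> Hom C (Dom C g) (Dom C k)" "k \<cdot> u = g" using k(3)[OF gH] by blast
  have "r \<cdot> g = null C (Dom C g) Z"
    using cmp_assoc[OF u(1) k(1) r] u(2) assms(5) null_cmp[OF u(1)] Hom_objects[OF r] by simp
  then show ?thesis using q(3)[OF r] HomD[OF e] that by auto
qed

text \<open>Epimorphisms are stable under pullback; this form of the fact serves for diagram chases: an
  element \<open>g\<close> of the codomain lifts along \<open>e\<close> after restriction along another epimorphism. The
  pullback is the kernel \<open>k\<close> of \<open>d = (e, - g)\<close>. If \<open>r\<close> vanishes on its projection to \<open>Y\<close>, then
  \<open>r \<cdot> p2\<close> factors through \<open>d\<close>, by \<open>epic_factor\<close>; as \<open>r \<cdot> p2\<close> is zero on the summand \<open>X\<close> and \<open>d\<close> is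
  \<open>e\<close> there, the factor is zero.\<close>

lemma epic_lift:
  assumes "epic C e" and e: "e \<in> Hom C X Z" and g: "g \<in> Hom C Y Z"
  obtains W c x where "epic C c" "c \<in> Hom C W Y" "x \<in> Hom C W X" "e \<cdot> x = g \<cdot> c"
proof -
  have X: "X \<in> Obj C" and Y: "Y \<in> Obj C" using Hom_objects e g by blast+
  obtain S p1 p2 d where p1: "p1 \<in> Hom C S X" and p2: "p2 \<in> Hom C S Y" and d: "d \<in> Hom C S Z"
    and ker: "\<forall>W. \<forall>x \<in> Hom C W S. d \<cdot> x = null C W Z \<longleftrightarrow> e \<cdot> (p1 \<cdot> x) = g \<cdot> (p2 \<cdot> x)"
    and "\<exists>i \<in> Hom C X S. d \<cdot> i = e \<and> p2 \<cdot> i = null C X Y" and "epic C p2"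
    using difference_map[OF e g] by metis
  then obtain i where i: "i \<in> Hom C X S" "d \<cdot> i = e" "p2 \<cdot> i = null C X Y" by blast
  have "epic C d" using epic_of_epic_cmp[OF _ i(1) d] assms(1) i(2) by simp
  obtain K k where kH: "k \<in> Hom C K S" and k: "is_kernel C k d" using kernel_obtain[OF d] .
  have "epic C (p2 \<cdot> k)"
  proof (rule epicI_null[OF cmp_in_Hom[OF kH p2]])
    fix R r assume r: "r \<in> Hom C Y R" and "r \<cdot> (p2 \<cdot> k) = null C K R"
    then have "(r \<cdot> p2) \<cdot> k = null C (Dom C k) R" using cmp_assoc[OF kH p2 r] HomD[OF kH] by simp
    then obtain s where s: "s \<in> Hom C Z R" "s \<cdot> d = r \<cdot> p2"
      using epic_factor[OF \<open>epic C d\<close> d cmp_in_Hom[OF p2 r] k] by blast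
    have "s \<cdot> e = r \<cdot> (p2 \<cdot> i)"
      using cmp_assoc[OF i(1) d s(1)] cmp_assoc[OF i(1) p2 r] s(2) i(2) by simp
    also have "\<dots> = null C X R" using i(3) cmp_null[OF r X] by simp
    finally have "s = null C Z R" using epic_null[OF assms(1) e s(1)] by blast
    then have "r \<cdot> p2 = null C S R" using s(2) null_cmp[OF d] Hom_objects[OF r] by simp
    then show "r = null C Y R" using epic_null[OF \<open>epic C p2\<close> p2 r] by blast
  qed
  moreover have "e \<cdot> (p1 \<cdot> k) = g \<cdot> (p2 \<cdot> k)"
    using ker kH is_kernelD(2)[OF k d] HomD[OF kH] by simp
  ultimately show ?thesis using that cmp_in_Hom[OF kH p1] cmp_in_Hom[OF kH p2] by blast
qed

lemma exact_at_HomD: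
  assumes "exact_at C f g"
  shows "f \<in> Hom C (Dom C f) (Cod C f)" "g \<in> Hom C (Cod C f) (Cod C g)" "Dom C g = Cod C f"
  using assms by (auto simp: exact_at_def is_image_def is_kernel_def is_cokernel_def Hom_def)

text \<open>That \<open>e\<close> is epic comes from every monomorphism being a kernel. If \<open>r \<cdot> e = 0\<close>, then \<open>f\<close> already
  factors through the subobject \<open>m \<cdot> k\<close> of the image, where \<open>k\<close> is the kernel of \<open>r\<close>. This subobject
  is the kernel of some \<open>s\<close>, which kills \<open>f\<close> and hence its image \<open>m\<close>; so \<open>k\<close> is all of the image and
  \<open>r = 0\<close>.\<close>

lemma is_image_factor:
  assumes m: "is_image C m f" and f: "f \<in> Hom C X Y"
  obtains e where "epic C e" "e \<in> Hom C X (Dom C m)" "m \<cdot> e = f" "m \<in> Hom C (Dom C m) Y"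
proof -
  obtain q where q: "is_cokernel C q f" and mk: "is_kernel C m q"
    using m by (auto simp: is_image_def)
  note cq = is_cokernelD[OF q f]
  note km = is_kernelD[OF mk cq(1)]
  obtain e where e: "e \<in> Hom C X (Dom C m)" "m \<cdot> e = f" using km(3)[OF f cq(2)] by blast
  have "epic C e"
  proof (rule epicI_null[OF e(1)])
    fix R r assume r: "r \<in> Hom C (Dom C m) R" and re: "r \<cdot> e = null C X R"
    obtain K k where kH: "k \<in> Hom C K (Dom C m)" and k: "is_kernel C k r" using kernel_obtain[OF r] .
    note kk = is_kernelD[OF k r]
    \<comment> \<open>\<open>f\<close> factors through the smaller subobject \<open>m \<cdot> k\<close>, which is the kernel of \<open>s\<close>.\<close>
    obtain e' where e': "e' \<in> Hom C X K" "k \<cdot> e' = e" using kk(3)[OF e(1) re] unfolding HomD(2)[OF kH] by blast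
    have mkH: "m \<cdot> k \<in> Hom C K Y" using cmp_in_Hom[OF kH km(1)] .
    have "monic C (m \<cdot> k)" using monic_cmp[OF is_kernel_monic[OF k] kH is_kernel_monic[OF mk] km(1)] .
    then obtain s where s: "is_kernel C (m \<cdot> k) s" using monic_is_kernel by blast
    have sH: "s \<in> Hom C Y (Cod C s)" using s HomD[OF mkH] by (auto simp: is_kernel_def Hom_def)
    note ks = is_kernelD[OF s sH]
    have kD: "Dom C (m \<cdot> k) = K" using HomD[OF mkH] by simp
    have O: "Cod C s \<in> Obj C" using Hom_objects[OF sH] by simp
    have "f = (m \<cdot> k) \<cdot> e'" using cmp_assoc[OF e'(1) kH km(1)] e e' by simp
    then have "s \<cdot> f = null C X (Cod C s)"
      using cmp_assoc[OF e'(1) mkH sH] ks(2) kD null_cmp[OF e'(1) O] by simp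
    then obtain t where t: "t \<in> Hom C (Cod C q) (Cod C s)" "t \<cdot> q = s" using cq(3)[OF sH] by blast
    have "s \<cdot> m = null C (Dom C m) (Cod C s)"
      using cmp_assoc[OF km(1) cq(1) t(1)] t(2) km(2) cmp_null[OF t(1)] Hom_objects[OF km(1)] by simp
    then obtain u where u: "u \<in> Hom C (Dom C m) K" "(m \<cdot> k) \<cdot> u = m"
      using ks(3)[OF km(1)] unfolding kD by blast
    have ku: "k \<cdot> u \<in> Hom C (Dom C m) (Dom C m)" using cmp_in_Hom[OF u(1) kH] .
    have id: "ident C (Dom C m) \<in> Hom C (Dom C m) (Dom C m)" using ident_in_Hom Hom_objects[OF km(1)] by blast
    have "m \<cdot> (k \<cdot> u) = m \<cdot> ident C (Dom C m)"
      using cmp_assoc[OF u(1) kH km(1)] u(2) cmp_ident[OF km(1)] by simp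
    then have "k \<cdot> u = ident C (Dom C m)" using monicD[OF is_kernel_monic[OF mk] km(1) ku id] by blast
    then have "r = (r \<cdot> k) \<cdot> u" using cmp_assoc[OF u(1) kH r] cmp_ident[OF r] by simp
    then show "r = null C (Dom C m) R"
      using kk(2) HomD[OF kH] null_cmp[OF u(1)] Hom_objects[OF r] by simp
  qed
  then show ?thesis using that e km(1) by blast
qed

text \<open>A generalized element \<open>x\<close> killed by \<open>g\<close> factors through the image of \<open>f\<close>, and \<open>f\<close> maps
  epimorphically onto its image, so a lift of \<open>x\<close> along \<open>f\<close> exists only after restriction along an
  epimorphism \<open>c\<close>. Conversely, applied to the kernel \<open>m\<close> of \<open>g\<close>, the condition shows that the cokernel
  of \<open>f\<close> kills \<open>m\<close>, and this identifies \<open>m\<close> with the image of \<open>f\<close>.\<close>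

lemma exact_at_iff:
  assumes f: "f \<in> Hom C X Y" and g: "g \<in> Hom C Y Z"
  shows "exact_at C f g \<longleftrightarrow> g \<cdot> f = null C X Z \<and>
    (\<forall>W x. x \<in> Hom C W Y \<and> g \<cdot> x = null C W Z \<longrightarrow>
      (\<exists>V c y. epic C c \<and> c \<in> Hom C V W \<and> y \<in> Hom C V X \<and> f \<cdot> y = x \<cdot> c))"
    (is "_ \<longleftrightarrow> ?R")
proof
  assume "exact_at C f g"
  then obtain m where im: "is_image C m f" and m: "is_kernel C m g" by (auto simp: exact_at_def)
  obtain e where e: "epic C e" "e \<in> Hom C X (Dom C m)" "m \<cdot> e = f" and mH: "m \<in> Hom C (Dom C m) Y"
    using is_image_factor[OF im f] .
  note km = is_kernelD[OF m g]
  show ?R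
  proof (intro conjI allI impI)
    show "g \<cdot> f = null C X Z"
      using cmp_assoc[OF e(2) mH g] e(3) km(2) null_cmp[OF e(2)] Hom_objects[OF g] by simp
    fix W x assume "x \<in> Hom C W Y \<and> g \<cdot> x = null C W Z"
    then obtain u where u: "u \<in> Hom C W (Dom C m)" "m \<cdot> u = x" using km(3) by blast
    obtain V c y where c: "epic C c" "c \<in> Hom C V W" "y \<in> Hom C V X" "e \<cdot> y = u \<cdot> c"
      using epic_lift[OF e(1,2) u(1)] .
    have "f \<cdot> y = x \<cdot> c"
      using cmp_assoc[OF c(3) e(2) mH] cmp_assoc[OF c(2) u(1) mH] c(4) e(3) u(2) by simp
    then show "\<exists>V c y. epic C c \<and> c \<in> Hom C V W \<and> y \<in> Hom C V X \<and> f \<cdot> y = x \<cdot> c" using c by blast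
  qed
next
  assume R: ?R
  obtain K m where mH: "m \<in> Hom C K Y" and m: "is_kernel C m g" using kernel_obtain[OF g] .
  note km = is_kernelD[OF m g]
  have mD: "Dom C m = K" using HomD[OF mH] by simp
  obtain q where q: "is_cokernel C q f" using cokernel_exists HomD(1)[OF f] by blast
  note cq = is_cokernelD[OF q f]
  have O: "Cod C q \<in> Obj C" using Hom_objects[OF cq(1)] by simp
  have "is_kernel C m q"
  proof (rule is_kernelI[OF cq(1) mH is_kernel_monic[OF m]])
    obtain V c y where c: "epic C c" "c \<in> Hom C V K" "y \<in> Hom C V X" "f \<cdot> y = m \<cdot> c"
      using R mH km(2) mD by blast
    have "(q \<cdot> m) \<cdot> c = null C V (Cod C q)"
      using cmp_assoc[OF c(2) mH cq(1)] cmp_assoc[OF c(3) f cq(1)] c(4) cq(2) null_cmp[OF c(3) O] by simp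
    then show "q \<cdot> m = null C K (Cod C q)" using epic_null[OF c(1,2) cmp_in_Hom[OF mH cq(1)]] by blast
  next
    fix W h assume h: "h \<in> Hom C W Y" and qh: "q \<cdot> h = null C W (Cod C q)"
    obtain v where v: "v \<in> Hom C (Cod C q) Z" "v \<cdot> q = g" using cq(3)[OF g] R by blast
    have "g \<cdot> h = null C W Z"
      using cmp_assoc[OF h cq(1) v(1)] v(2) qh cmp_null[OF v(1)] Hom_objects[OF h] by simp
    then show "\<exists>u. u \<in> Hom C W K \<and> m \<cdot> u = h" using km(3)[OF h] unfolding mD by blast
  qed
  then show "exact_at C f g" using q m by (auto simp: exact_at_def is_image_def)
qed

lemma exact_at_null_left:
  assumes "zero_object C Z" and h: "h \<in> Hom C X Y"
  shows "exact_at C (null C Z X) h \<longleftrightarrow> monic C h"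
proof -
  have O: "Z \<in> Obj C" "X \<in> Obj C" "Y \<in> Obj C"
    using assms Hom_objects[OF h] by (auto simp: zero_object_def)
  have n: "null C Z X \<in> Hom C Z X" using null_in_Hom O by blast
  show ?thesis
  proof
    assume ex: "exact_at C (null C Z X) h"
    show "monic C h"
    proof (rule monicI_null[OF h])
      fix W x assume x: "x \<in> Hom C W X" "h \<cdot> x = null C W Y"
      then obtain V c y where c: "epic C c" "c \<in> Hom C V W" "y \<in> Hom C V Z" "null C Z X \<cdot> y = x \<cdot> c"
        using ex exact_at_iff[OF n h] by blast
      then have "x \<cdot> c = null C V X" using null_cmp[OF c(3)] O by simp
      then show "x = null C W X" using epic_null[OF c(1,2) x(1)] by blast
    qed
  next
    assume m: "monic C h"
    have "\<exists>V c y. epic C c \<and> c \<in> Hom C V W \<and> y \<in> Hom C V Z \<and> null C Z X \<cdot> y = x \<cdot> c"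
      if x: "x \<in> Hom C W X" "h \<cdot> x = null C W Y" for W x
    proof -
      have W: "W \<in> Obj C" using Hom_objects[OF x(1)] by simp
      have "x = null C W X" using monic_null[OF m h x] .
      then have "null C Z X \<cdot> null C W Z = x \<cdot> ident C W"
        using cmp_null[OF n W] cmp_ident[OF x(1)] by simp
      then show ?thesis using ident_epic[OF W] ident_in_Hom[OF W] null_in_Hom[OF W O(1)] by blast
    qed
    then show "exact_at C (null C Z X) h"
      using exact_at_iff[OF n h] cmp_null[OF h] O by simp
  qed
qed

lemma exact_at_null_right:
  assumes "zero_object C Z" and h: "h \<in> Hom C X Y"
  shows "exact_at C h (null C Y Z) \<longleftrightarrow> epic C h"
proof -
  have O: "Z \<in> Obj C" "X \<in> Obj C" "Y \<in> Obj C"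
    using assms Hom_objects[OF h] by (auto simp: zero_object_def)
  have n: "null C Y Z \<in> Hom C Y Z" using null_in_Hom O by blast
  show ?thesis
  proof
    assume ex: "exact_at C h (null C Y Z)"
    have id: "ident C Y \<in> Hom C Y Y" using ident_in_Hom O by blast
    obtain V c y where c: "epic C c" "c \<in> Hom C V Y" "y \<in> Hom C V X" "h \<cdot> y = ident C Y \<cdot> c"
      using ex exact_at_iff[OF h n] id cmp_ident[OF n] by metis
    then have "epic C (h \<cdot> y)" using ident_cmp[OF c(2)] by simp
    then show "epic C h" using epic_of_epic_cmp[OF _ c(3) h] by blast
  next
    assume e: "epic C h"
    have "\<exists>V c y. epic C c \<and> c \<in> Hom C V W \<and> y \<in> Hom C V X \<and> h \<cdot> y = x \<cdot> c"
      if x: "x \<in> Hom C W Y" for W x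
      using epic_lift[OF e h x] by metis
    then show "exact_at C h (null C Y Z)"
      using exact_at_iff[OF h n] null_cmp[OF h] O by simp
  qed
qed

text \<open>Exactness at the middle object depends on the second arrow through its kernel, and on the first
  one through its image.\<close>

lemma exact_at_monic_cmp:
  assumes ex: "exact_at C f g" and "monic C m" and m: "m \<in> Hom C (Cod C g) Z"
  shows "exact_at C f (m \<cdot> g)"
proof -
  note H = exact_at_HomD(1,2)[OF ex]
  have "(m \<cdot> g) \<cdot> x = null C W Z \<longleftrightarrow> g \<cdot> x = null C W (Cod C g)"
    if x: "x \<in> Hom C W (Cod C f)" for W x
    unfolding cmp_assoc[OF x H(2) m]
    using monic_null[OF assms(2) m cmp_in_Hom[OF x H(2)]] cmp_null[OF m Hom_objects(1)[OF x]] by metis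
  note zero = this
  note R = ex[unfolded exact_at_iff[OF H]]
  show ?thesis
    unfolding exact_at_iff[OF H(1) cmp_in_Hom[OF H(2) m]]
  proof (intro conjI allI impI)
    show "(m \<cdot> g) \<cdot> f = null C (Dom C f) Z" using zero[OF H(1)] R by simp
    fix W x assume "x \<in> Hom C W (Cod C f) \<and> (m \<cdot> g) \<cdot> x = null C W Z"
    then have "x \<in> Hom C W (Cod C f) \<and> g \<cdot> x = null C W (Cod C g)" using zero by blast
    then show "\<exists>V c y. epic C c \<and> c \<in> Hom C V W \<and> y \<in> Hom C V (Dom C f) \<and> f \<cdot> y = x \<cdot> c"
      using R by blast
  qed
qed

lemma exact_at_cmp_epic:
  assumes ex: "exact_at C f g" and "epic C e" and e: "e \<in> Hom C Z (Dom C f)"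
  shows "exact_at C (f \<cdot> e) g"
  unfolding exact_at_iff[OF cmp_in_Hom[OF e exact_at_HomD(1)[OF ex]] exact_at_HomD(2)[OF ex]]
proof (intro conjI allI impI)
  note H = exact_at_HomD(1,2)[OF ex]
  note R = ex[unfolded exact_at_iff[OF H]]
  show "g \<cdot> (f \<cdot> e) = null C Z (Cod C g)"
    using cmp_assoc[OF e H] R null_cmp[OF e] Hom_objects[OF H(2)] by simp
  fix W x assume "x \<in> Hom C W (Cod C f) \<and> g \<cdot> x = null C W (Cod C g)"
  then obtain V c y where c: "epic C c" "c \<in> Hom C V W" "y \<in> Hom C V (Dom C f)" "f \<cdot> y = x \<cdot> c"
    and x: "x \<in> Hom C W (Cod C f)"
    using R by blast
  obtain U b z where b: "epic C b" "b \<in> Hom C U V" "z \<in> Hom C U Z" "e \<cdot> z = y \<cdot> b"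
    using epic_lift[OF assms(2) e c(3)] .
  have "(f \<cdot> e) \<cdot> z = x \<cdot> (c \<cdot> b)"
    using cmp_assoc[OF b(3) e H(1)] b(4) cmp_assoc[OF b(2) c(3) H(1)] c(4) cmp_assoc[OF b(2) c(2) x]
    by simp
  then show "\<exists>V c y. epic C c \<and> c \<in> Hom C V W \<and> y \<in> Hom C V Z \<and> (f \<cdot> e) \<cdot> y = x \<cdot> c"
    using b(3) epic_cmp[OF b(1,2) c(1,2)] cmp_in_Hom[OF b(2) c(2)] by blast
qed

text \<open>In the forward direction \<open>exact_at_iff\<close> gives lifts of cycles only locally. They descend because
  \<open>f\<close> is the kernel of some arrow \<open>s\<close>, and \<open>s \<cdot> x = 0\<close> can be tested after restriction along an
  epimorphism.\<close>

lemma monic_exact_at_iff_kernel: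
  assumes "monic C f" and f: "f \<in> Hom C X Y" and g: "g \<in> Hom C Y Z"
  shows "exact_at C f g \<longleftrightarrow> is_kernel C f g"
proof
  assume ex: "exact_at C f g"
  obtain s where s: "is_kernel C f s" using monic_is_kernel[OF assms(1)] by blast
  have sH: "s \<in> Hom C Y (Cod C s)" using s HomD[OF f] by (auto simp: is_kernel_def Hom_def)
  note ks = is_kernelD[OF s sH]
  show "is_kernel C f g"
  proof (rule is_kernelI[OF g f assms(1)])
    show "g \<cdot> f = null C X Z" using ex exact_at_iff[OF f g] by blast
    fix W x assume x: "x \<in> Hom C W Y" "g \<cdot> x = null C W Z"
    then obtain V c y where c: "epic C c" "c \<in> Hom C V W" "y \<in> Hom C V X" "f \<cdot> y = x \<cdot> c"
      using ex exact_at_iff[OF f g] by blast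
    have "(s \<cdot> x) \<cdot> c = null C V (Cod C s)"
      using cmp_assoc[OF c(2) x(1) sH] cmp_assoc[OF c(3) f sH] c(4) ks(2) HomD[OF f]
        null_cmp[OF c(3)] Hom_objects[OF sH] by simp
    then have "s \<cdot> x = null C W (Cod C s)" using epic_null[OF c(1,2) cmp_in_Hom[OF x(1) sH]] by blast
    then show "\<exists>u. u \<in> Hom C W X \<and> f \<cdot> u = x" using ks(3)[OF x(1)] unfolding HomD(2)[OF f] by blast
  qed
next
  assume k: "is_kernel C f g"
  note kf = is_kernelD[OF k g]
  have "\<exists>V c y. epic C c \<and> c \<in> Hom C V W \<and> y \<in> Hom C V X \<and> f \<cdot> y = x \<cdot> c"
    if x: "x \<in> Hom C W Y" "g \<cdot> x = null C W Z" for W x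
  proof -
    have W: "W \<in> Obj C" using Hom_objects[OF x(1)] by simp
    obtain u where "u \<in> Hom C W X" "f \<cdot> u = x" using kf(3)[OF x] unfolding HomD(2)[OF f] by blast
    then show ?thesis using ident_epic[OF W] ident_in_Hom[OF W] cmp_ident[OF x(1)] by metis
  qed
  then show "exact_at C f g" using exact_at_iff[OF f g] kf(2) HomD[OF f] by simp
qed

section \<open>Splicing exact sequences\<close>

lemma exact_sequence_Cons:
  "exact_sequence C (f # g # fs) \<longleftrightarrow> exact_at C f g \<and> exact_sequence C (g # fs)"
  unfolding exact_sequence_def
proof safe
  fix k assume "\<forall>k. Suc k < length (f # g # fs) \<longrightarrow> exact_at C ((f # g # fs) ! k) ((f # g # fs) ! Suc k)"
    and "Suc k < length (g # fs)"
  then show "exact_at C ((g # fs) ! k) ((g # fs) ! Suc k)" by (metis Suc_less_eq length_Cons nth_Cons_Suc)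
next
  fix k assume "exact_at C f g" "\<forall>k. Suc k < length (g # fs) \<longrightarrow> exact_at C ((g # fs) ! k) ((g # fs) ! Suc k)"
    "Suc k < length (f # g # fs)"
  then show "exact_at C ((f # g # fs) ! k) ((f # g # fs) ! Suc k)" by (cases k) auto
qed force

lemma exact_sequence_single: "exact_sequence C [f]"
  by (simp add: exact_sequence_def)

lemma short_exact_iff:
  assumes f: "f \<in> Hom C X Y" and g: "g \<in> Hom C Y Z"
  shows "short_exact C f g \<longleftrightarrow> is_kernel C f g \<and> epic C g"
proof -
  have "short_exact C f g \<longleftrightarrow> (\<exists>N. zero_object C N \<and> monic C f \<and> exact_at C f g \<and> epic C g)"
    using exact_at_null_left[OF _ f] exact_at_null_right[OF _ g] HomD[OF f] HomD[OF g]
    by (auto simp: short_exact_def exact_between_zeros_def exact_sequence_Cons exact_sequence_single)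
  also have "\<dots> \<longleftrightarrow> is_kernel C f g \<and> epic C g"
    using zero_object_exists monic_exact_at_iff_kernel[OF _ f g] is_kernel_monic by metis
  finally show ?thesis .
qed

lemma exact_between_zeros_ident:
  assumes "X \<in> Obj C"
  shows "exact_between_zeros C [ident C X]"
proof -
  obtain Z where "zero_object C Z" using zero_object_exists .
  then show ?thesis
    using exact_at_null_left[OF _ ident_in_Hom[OF assms]] exact_at_null_right[OF _ ident_in_Hom[OF assms]]
      HomD[OF ident_in_Hom[OF assms]] ident_monic[OF assms] ident_epic[OF assms]
    by (auto simp: exact_between_zeros_def exact_sequence_Cons exact_sequence_single)
qed

lemma exact_between_zeros_hd:
  assumes "exact_between_zeros C (h # t)"
  shows "h \<in> Hom C (Dom C h) (Cod C h)"
proof -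
  obtain Z where "exact_sequence C (null C Z (Dom C h) # h # t @ [null C (Cod C (last (h # t))) Z])"
    using assms by (auto simp: exact_between_zeros_def)
  then have "exact_at C (null C Z (Dom C h)) h" by (simp only: exact_sequence_Cons append_Cons)
  then show ?thesis using HomD(1)[OF exact_at_HomD(2)] by (simp add: Hom_def)
qed

text \<open>One step in the construction of a resolution to the left: the first object \<open>X\<close>, which embeds
  by \<open>h\<close>, is covered by \<open>P\<close>. Since \<open>h\<close> is monic and \<open>p\<close> is epic, \<open>h \<cdot> p\<close> has the kernel of \<open>p\<close> and the
  image of \<open>h\<close>.\<close>

lemma exact_between_zeros_splice:
  assumes ex: "exact_between_zeros C (h # t)" and h: "h \<in> Hom C X Y"
    and k: "k \<in> Hom C K P" and p: "p \<in> Hom C P X" and ker: "is_kernel C k p" and "epic C p"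
  shows "exact_between_zeros C (k # (h \<cdot> p) # t)"
proof -
  define l where "l = Cod C (last (h # t))"
  obtain Z where Z: "zero_object C Z" and seq0: "exact_sequence C (null C Z X # h # t @ [null C l Z])"
    using ex HomD[OF h] by (auto simp: exact_between_zeros_def l_def)
  from seq0 have mh: "monic C h" and seq: "exact_sequence C (h # t @ [null C l Z])"
    using Z exact_at_null_left[OF _ h] by (auto simp: exact_sequence_Cons)
  have hp: "h \<cdot> p \<in> Hom C P Y" using cmp_in_Hom[OF p h] .
  have l: "Cod C (last (k # (h \<cdot> p) # t)) = l"
    using HomD[OF h] HomD[OF hp] by (simp add: l_def)
  obtain u us where u: "t @ [null C l Z] = u # us" by (cases t) auto
  have "exact_at C h u" "exact_sequence C (u # us)" using seq u by (auto simp: exact_sequence_Cons)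
  then have "exact_sequence C ((h \<cdot> p) # u # us)"
    using exact_at_cmp_epic[OF _ assms(6)] p HomD[OF h] by (auto simp: exact_sequence_Cons)
  moreover have "exact_at C k (h \<cdot> p)"
    using exact_at_monic_cmp[OF _ mh] monic_exact_at_iff_kernel[OF is_kernel_monic[OF ker] k p]
      ker h HomD[OF p] by auto
  moreover have "exact_at C (null C Z K) k"
    using exact_at_null_left[OF Z k] is_kernel_monic[OF ker] by simp
  ultimately have "exact_sequence C (null C Z K # k # (h \<cdot> p) # t @ [null C l Z])"
    using u by (simp add: exact_sequence_Cons)
  then show ?thesis using Z l HomD[OF k] by (auto simp: exact_between_zeros_def)
qed

end

section \<open>Short exact sequences of syzygies\<close>

text \<open>Membership in the classes \<open>\<F>\<^sub>n\<close> concerns objects, so the arrows of a short exact sequence are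
  hidden. Kernel and epimorphism are what the chases use; \<open>short_exact_iff\<close> relates this to
  \<open>short_exact\<close>.\<close>

definition extension :: "('o, 'm, 'z) cat_scheme \<Rightarrow> 'o \<Rightarrow> 'o \<Rightarrow> 'o \<Rightarrow> bool"
  where "extension C X Y Z \<longleftrightarrow> (\<exists>f \<in> Hom C X Y. \<exists>g \<in> Hom C Y Z. is_kernel C f g \<and> epic C g)"

context abelian_category
begin

lemma extension_of_epic:
  assumes "epic C p" "p \<in> Hom C P M"
  obtains K where "extension C K P M"
  using kernel_obtain[OF assms(2)] assms unfolding extension_def by blast

text \<open>Both \<open>L\<close> and \<open>X\<close> are kernels, of \<open>g \<cdot> p\<close> and of \<open>g\<close>, so \<open>L\<close> is the inverse image of \<open>X\<close> under \<open>p\<close>: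
  it maps onto \<open>X\<close> with the kernel of \<open>p\<close>.\<close>

lemma extension_pullback:
  assumes "extension C X Y Z" and "epic C p" and p: "p \<in> Hom C P Y"
  obtains K L where "extension C K P Y" "extension C L P Z" "extension C K L X"
proof -
  obtain f g where f: "f \<in> Hom C X Y" and g: "g \<in> Hom C Y Z" and ker: "is_kernel C f g" and "epic C g"
    using assms(1) unfolding extension_def by blast
  note kf = is_kernelD[OF ker g]
  have fD: "Dom C f = X" using HomD[OF f] by simp
  have gp: "g \<cdot> p \<in> Hom C P Z" using cmp_in_Hom[OF p g] .
  have egp: "epic C (g \<cdot> p)" using epic_cmp[OF assms(2) p \<open>epic C g\<close> g] .
  obtain K k where k: "k \<in> Hom C K P" and kk: "is_kernel C k p" using kernel_obtain[OF p] .
  obtain L l where l: "l \<in> Hom C L P" and kl: "is_kernel C l (g \<cdot> p)" using kernel_obtain[OF gp] .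
  note Kk = is_kernelD[OF kk p] and Kl = is_kernelD[OF kl gp]
  have KD: "Dom C k = K" "Dom C l = L" using HomD[OF k] HomD[OF l] by simp_all
  have pl: "p \<cdot> l \<in> Hom C L Y" using cmp_in_Hom[OF l p] .
  have "g \<cdot> (p \<cdot> l) = null C L Z" using cmp_assoc[OF l p g] Kl(2) KD by simp
  then obtain a where a: "a \<in> Hom C L X" "f \<cdot> a = p \<cdot> l" using kf(3)[OF pl] unfolding fD by blast
  have pk: "p \<cdot> k = null C K Y" using Kk(2) KD by simp
  have "(g \<cdot> p) \<cdot> k = null C K Z"
    using cmp_assoc[OF k p g] pk cmp_null[OF g] Hom_objects[OF k] by simp
  then obtain k' where k': "k' \<in> Hom C K L" "l \<cdot> k' = k" using Kl(3)[OF k] unfolding KD by blast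
  have iff: "a \<cdot> x = null C W X \<longleftrightarrow> p \<cdot> (l \<cdot> x) = null C W Y" if x: "x \<in> Hom C W L" for W x
    unfolding cmp_assoc[OF x l p, symmetric] a(2)[symmetric] cmp_assoc[OF x a(1) f]
    using monic_null[OF is_kernel_monic[OF ker] f cmp_in_Hom[OF x a(1)]]
      cmp_null[OF f Hom_objects(1)[OF x]] by metis
  have "is_kernel C k' a"
  proof (rule is_kernelI[OF a(1) k'(1)])
    show "monic C k'" using monic_of_monic_cmp[OF _ k'(1) l] k'(2) is_kernel_monic[OF kk] by simp
    show "a \<cdot> k' = null C K X" using iff[OF k'(1)] k'(2) pk by simp
    fix W x assume x: "x \<in> Hom C W L" "a \<cdot> x = null C W X"
    then obtain u where u: "u \<in> Hom C W K" "k \<cdot> u = l \<cdot> x"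
      using Kk(3)[OF cmp_in_Hom[OF x(1) l]] iff[OF x(1)] unfolding KD by blast
    have "l \<cdot> (k' \<cdot> u) = l \<cdot> x" using cmp_assoc[OF u(1) k'(1) l] u(2) k'(2) by simp
    then have "k' \<cdot> u = x" using monicD[OF is_kernel_monic[OF kl] l cmp_in_Hom[OF u(1) k'(1)] x(1)] by blast
    then show "\<exists>u. u \<in> Hom C W K \<and> k' \<cdot> u = x" using u by blast
  qed
  moreover have "epic C a"
  proof -
    obtain V c y where c: "epic C c" "c \<in> Hom C V X" "y \<in> Hom C V P" "p \<cdot> y = f \<cdot> c"
      using epic_lift[OF assms(2) p f] .
    have "(g \<cdot> p) \<cdot> y = null C V Z"
      using cmp_assoc[OF c(3) p g] c(4) cmp_assoc[OF c(2) f g] kf(2) fD null_cmp[OF c(2)] Hom_objects[OF g]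
      by simp
    then obtain u where u: "u \<in> Hom C V L" "l \<cdot> u = y" using Kl(3)[OF c(3)] unfolding KD by blast
    have "f \<cdot> (a \<cdot> u) = f \<cdot> c"
      using cmp_assoc[OF u(1) a(1) f] a(2) cmp_assoc[OF u(1) l p] u(2) c(4) by simp
    then have "a \<cdot> u = c"
      using monicD[OF is_kernel_monic[OF ker] f cmp_in_Hom[OF u(1) a(1)] c(2)] by blast
    then show ?thesis using epic_of_epic_cmp[OF _ u(1) a(1)] c(1) by simp
  qed
  ultimately have "extension C K L X" using k'(1) a(1) unfolding extension_def by blast
  moreover have "extension C K P Y" "extension C L P Z"
    using k kk p assms(2) l kl gp egp unfolding extension_def by blast+
  ultimately show ?thesis using that by blast
qed

text \<open>The sequence \<open>K \<rightarrow> R \<rightarrow> P \<rightarrow> Z\<close> is a mapping cone over the given one. With \<open>f\<close> and \<open>g\<close> the arrows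
  of the given sequence, \<open>S\<close> is \<open>P \<oplus> Q\<close>, and \<open>R\<close> consists of the pairs \<open>(x, y)\<close> with
  \<open>p \<cdot> x = f \<cdot> q \<cdot> y\<close>. The possible first components are the \<open>x\<close> whose image under \<open>p\<close> lies in \<open>X\<close>, since
  \<open>q\<close> is onto \<open>X\<close>; they form \<open>L\<close>. The pairs with \<open>x = 0\<close> have \<open>q \<cdot> y = 0\<close>, since \<open>f\<close> is monic; they form
  \<open>K\<close>.

  The point of working with \<open>R\<close> is that it is a first syzygy of \<open>Y\<close>, so its dimension is
  known although it is built from \<open>X\<close> as well.\<close>

lemma extension_mapping_cone:
  assumes "extension C X Y Z" and "epic C p" and p: "p \<in> Hom C P Y" and "epic C q" and q: "q \<in> Hom C Q X"
  obtains K L R S where "extension C K Q X" "extension C L P Z" "extension C R S Y" "extension C K R L"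
    and "\<forall>\<F>. closed_under_finite_direct_sums C \<F> \<longrightarrow> P \<in> \<F> \<longrightarrow> Q \<in> \<F> \<longrightarrow> S \<in> \<F>"
proof -
  obtain f g where f: "f \<in> Hom C X Y" and g: "g \<in> Hom C Y Z" and ker: "is_kernel C f g" and "epic C g"
    using assms(1) unfolding extension_def by blast
  note kf = is_kernelD[OF ker g]
  have fD: "Dom C f = X" using HomD[OF f] by simp
  have gp: "g \<cdot> p \<in> Hom C P Z" using cmp_in_Hom[OF p g] .
  have egp: "epic C (g \<cdot> p)" using epic_cmp[OF assms(2) p \<open>epic C g\<close> g] .
  have fq: "f \<cdot> q \<in> Hom C Q Y" using cmp_in_Hom[OF q f] .
  obtain K k where k: "k \<in> Hom C K Q" and kk: "is_kernel C k q" using kernel_obtain[OF q] .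
  obtain L l where l: "l \<in> Hom C L P" and kl: "is_kernel C l (g \<cdot> p)" using kernel_obtain[OF gp] .
  note Kk = is_kernelD[OF kk q] and Kl = is_kernelD[OF kl gp]
  have KD: "Dom C k = K" "Dom C l = L" using HomD[OF k] HomD[OF l] by simp_all
  obtain S p1 p2 d where p1: "p1 \<in> Hom C S P" and p2: "p2 \<in> Hom C S Q" and d: "d \<in> Hom C S Y"
    and dker: "\<forall>W. \<forall>x \<in> Hom C W S. d \<cdot> x = null C W Y \<longleftrightarrow> p \<cdot> (p1 \<cdot> x) = (f \<cdot> q) \<cdot> (p2 \<cdot> x)"
    and pair: "\<forall>W. \<forall>x \<in> Hom C W P. \<forall>y \<in> Hom C W Q. \<exists>z \<in> Hom C W S. p1 \<cdot> z = x \<and> p2 \<cdot> z = y"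
    and joint: "\<forall>W. \<forall>z \<in> Hom C W S. \<forall>z' \<in> Hom C W S. p1 \<cdot> z = p1 \<cdot> z' \<longrightarrow> p2 \<cdot> z = p2 \<cdot> z' \<longrightarrow> z = z'"
    and inj: "\<exists>i \<in> Hom C P S. d \<cdot> i = p \<and> p2 \<cdot> i = null C P Q"
    and "epic C p2"
    and sums: "\<forall>\<F>. closed_under_finite_direct_sums C \<F> \<longrightarrow> P \<in> \<F> \<longrightarrow> Q \<in> \<F> \<longrightarrow> S \<in> \<F>"
    using difference_map[OF p fq] .
  note dker = dker[rule_format] and pair = pair[rule_format] and joint = joint[rule_format]
  obtain i where i: "i \<in> Hom C P S" "d \<cdot> i = p" using inj by blast
  have "epic C d" using epic_of_epic_cmp[OF _ i(1) d] assms(2) i(2) by simp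
  obtain R r where r: "r \<in> Hom C R S" and kr: "is_kernel C r d" using kernel_obtain[OF d] .
  note Kr = is_kernelD[OF kr d]
  have rD: "Dom C r = R" using HomD[OF r] by simp
  have p1r: "p1 \<cdot> r \<in> Hom C R P" and p2r: "p2 \<cdot> r \<in> Hom C R Q" using cmp_in_Hom[OF r p1] cmp_in_Hom[OF r p2] by blast+
  have dr: "p \<cdot> (p1 \<cdot> r) = (f \<cdot> q) \<cdot> (p2 \<cdot> r)" using dker[OF r] Kr(2) rD by simp
  have qp: "q \<cdot> (p2 \<cdot> r) \<in> Hom C R X" using cmp_in_Hom[OF p2r q] .
  have "(g \<cdot> p) \<cdot> (p1 \<cdot> r) = g \<cdot> (f \<cdot> (q \<cdot> (p2 \<cdot> r)))"
    using cmp_assoc[OF p1r p g] dr cmp_assoc[OF p2r q f] by simp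
  also have "\<dots> = null C R Z"
    using cmp_assoc[OF qp f g] kf(2) fD null_cmp[OF qp] Hom_objects[OF g] by simp
  finally obtain b where b: "b \<in> Hom C R L" "l \<cdot> b = p1 \<cdot> r" using Kl(3)[OF p1r] unfolding KD by blast
  have KO: "K \<in> Obj C" using Hom_objects[OF k] by simp
  \<comment> \<open>\<open>j\<close> is the pair \<open>(0, k)\<close>, and \<open>k'\<close> the same element regarded as one of \<open>R\<close>.\<close>
  obtain j where j: "j \<in> Hom C K S" "p1 \<cdot> j = null C K P" "p2 \<cdot> j = k"
    using pair[OF null_in_Hom k] KO Hom_objects[OF p] by blast
  have "d \<cdot> j = null C K Y"
    using dker[OF j(1)] j(2,3) cmp_null[OF p KO] cmp_assoc[OF k q f] Kk(2) KD cmp_null[OF f KO] by simp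
  then obtain k' where k': "k' \<in> Hom C K R" "r \<cdot> k' = j" using Kr(3)[OF j(1)] unfolding rD by blast
  have p2rk: "(p2 \<cdot> r) \<cdot> k' = k" using cmp_assoc[OF k'(1) r p2] k'(2) j(3) by simp
  have "is_kernel C k' b"
  proof (rule is_kernelI[OF b(1) k'(1)])
    show "monic C k'"
      using monic_of_monic_cmp[OF _ k'(1) p2r] p2rk is_kernel_monic[OF kk] by simp
    have "l \<cdot> (b \<cdot> k') = null C K P"
      using cmp_assoc[OF k'(1) b(1) l] b(2) cmp_assoc[OF k'(1) r p1] k'(2) j(2) by simp
    then show "b \<cdot> k' = null C K L"
      using monic_null[OF is_kernel_monic[OF kl] l cmp_in_Hom[OF k'(1) b(1)]] by blast
    fix W x assume x: "x \<in> Hom C W R" "b \<cdot> x = null C W L"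
    have W: "W \<in> Obj C" using Hom_objects[OF x(1)] by simp
    have rx: "r \<cdot> x \<in> Hom C W S" using cmp_in_Hom[OF x(1) r] .
    have y: "p2 \<cdot> (r \<cdot> x) \<in> Hom C W Q" using cmp_in_Hom[OF rx p2] .
    have z: "p1 \<cdot> (r \<cdot> x) = null C W P"
      using cmp_assoc[OF x(1) r p1] b(2) cmp_assoc[OF x(1) b(1) l] x(2) cmp_null[OF l W] by simp
    have "d \<cdot> (r \<cdot> x) = null C W Y"
      using cmp_assoc[OF x(1) r d] Kr(2) rD null_cmp[OF x(1)] Hom_objects[OF p] by simp
    then have "f \<cdot> (q \<cdot> (p2 \<cdot> (r \<cdot> x))) = null C W Y"
      using dker[OF rx] z cmp_null[OF p W] cmp_assoc[OF y q f] by simp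
    then have "q \<cdot> (p2 \<cdot> (r \<cdot> x)) = null C W X"
      using monic_null[OF is_kernel_monic[OF ker] f cmp_in_Hom[OF y q]] by blast
    then obtain u where u: "u \<in> Hom C W K" "k \<cdot> u = p2 \<cdot> (r \<cdot> x)" using Kk(3)[OF y] unfolding KD by blast
    have ju: "j \<cdot> u \<in> Hom C W S" using cmp_in_Hom[OF u(1) j(1)] .
    have "j \<cdot> u = r \<cdot> x"
    proof (rule joint[OF ju rx])
      show "p1 \<cdot> (j \<cdot> u) = p1 \<cdot> (r \<cdot> x)"
        using cmp_assoc[OF u(1) j(1) p1] j(2) z null_cmp[OF u(1)] Hom_objects[OF p] by simp
      show "p2 \<cdot> (j \<cdot> u) = p2 \<cdot> (r \<cdot> x)"
        using cmp_assoc[OF u(1) j(1) p2] j(3) u(2) by simp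
    qed
    then have "r \<cdot> (k' \<cdot> u) = r \<cdot> x" using cmp_assoc[OF u(1) k'(1) r] k'(2) by simp
    then have "k' \<cdot> u = x"
      using monicD[OF is_kernel_monic[OF kr] r cmp_in_Hom[OF u(1) k'(1)] x(1)] by blast
    then show "\<exists>u. u \<in> Hom C W K \<and> k' \<cdot> u = x" using u by blast
  qed
  moreover have "epic C b"
  proof -
    have pl: "p \<cdot> l \<in> Hom C L Y" using cmp_in_Hom[OF l p] .
    have "g \<cdot> (p \<cdot> l) = null C L Z" using cmp_assoc[OF l p g] Kl(2) KD by simp
    then obtain a where a: "a \<in> Hom C L X" "f \<cdot> a = p \<cdot> l" using kf(3)[OF pl] unfolding fD by blast
    \<comment> \<open>Locally, an element of \<open>L\<close> has a partner \<open>y\<close> in \<open>Q\<close> with the same image in \<open>X\<close>.\<close>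
    obtain V c y where c: "epic C c" "c \<in> Hom C V L" "y \<in> Hom C V Q" "q \<cdot> y = a \<cdot> c"
      using epic_lift[OF assms(4) q a(1)] .
    have lc: "l \<cdot> c \<in> Hom C V P" using cmp_in_Hom[OF c(2) l] .
    obtain z where z: "z \<in> Hom C V S" "p1 \<cdot> z = l \<cdot> c" "p2 \<cdot> z = y" using pair[OF lc c(3)] by blast
    have "p \<cdot> (l \<cdot> c) = (f \<cdot> q) \<cdot> y"
      using cmp_assoc[OF c(2) l p] a(2) cmp_assoc[OF c(2) a(1) f] c(4) cmp_assoc[OF c(3) q f] by simp
    then obtain w where w: "w \<in> Hom C V R" "r \<cdot> w = z" using Kr(3)[OF z(1)] dker[OF z(1)] z(2,3) unfolding rD by simp blast
    have "l \<cdot> (b \<cdot> w) = l \<cdot> c"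
      using cmp_assoc[OF w(1) b(1) l] b(2) cmp_assoc[OF w(1) r p1] w(2) z(2) by simp
    then have "b \<cdot> w = c"
      using monicD[OF is_kernel_monic[OF kl] l cmp_in_Hom[OF w(1) b(1)] c(2)] by blast
    then show ?thesis using epic_of_epic_cmp[OF _ w(1) b(1)] c(1) by simp
  qed
  ultimately have "extension C K R L" using k'(1) b(1) unfolding extension_def by blast
  moreover have "extension C K Q X" "extension C L P Z" "extension C R S Y"
    using k kk q assms(4) l kl gp egp r kr d \<open>epic C d\<close> unfolding extension_def by blast+
  ultimately show ?thesis using that sums by blast
qed

lemma extension_short_exact:
  assumes "extension C X Y Z"
  obtains f g where "f \<in> Hom C X Y" "g \<in> Hom C Y Z" "short_exact C f g"
proof -
  obtain f g where "f \<in> Hom C X Y" "g \<in> Hom C Y Z" "is_kernel C f g" "epic C g"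
    using assms unfolding extension_def by blast
  then show ?thesis using that short_exact_iff by blast
qed

end

section \<open>Dimension shifting\<close>

locale homological_dimension = abelian_category +
  fixes \<F>
  assumes \<F>_Obj: "\<F> \<subseteq> Obj C"
    and dimension: "defines_homological_dimension C \<F>"
    and sums: "closed_under_finite_direct_sums C \<F>"
begin

lemma zero_object_in_\<F>: "zero_object C Z \<Longrightarrow> Z \<in> \<F>"
  using sums zero_object_is_direct_sum[of Z] unfolding closed_under_finite_direct_sums_def
  by (meson less_nat_zero_code)

lemma resolved_by_Obj: "M \<in> resolved_by C \<F> \<alpha> \<Longrightarrow> M \<in> Obj C"
  by (simp add: resolved_by_def)

lemma resolved_by_mono:
  assumes "\<alpha> \<le> \<beta>"
  shows "resolved_by C \<F> \<alpha> \<subseteq> resolved_by C \<F> \<beta>"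
proof -
  have "\<alpha> < enat i" if "\<beta> < enat i" for i using assms that by (rule le_less_trans)
  then show ?thesis unfolding resolved_by_def by blast
qed

lemma resolved_by_cover:
  assumes "M \<in> resolved_by C \<F> \<alpha>"
  obtains P p where "P \<in> \<F>" "p \<in> Hom C P M" "epic C p"
proof -
  obtain G e Z where "e \<in> Hom C (G 0) M" "zero_object C Z" "exact_at C e (null C M Z)"
    "G 0 \<in> \<F> \<or> zero_object C (G (0::nat))"
    using assms unfolding resolved_by_def by blast
  then show ?thesis using that exact_at_null_right zero_object_in_\<F> by blast
qed

text \<open>The resolution of \<open>M\<close> is \<open>M\<close> itself in degree zero.\<close>

lemma \<F>_resolved_by:
  assumes "M \<in> \<F>"
  shows "M \<in> resolved_by C \<F> \<alpha>"
proof -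
  have M: "M \<in> Obj C" using assms \<F>_Obj by blast
  obtain Z where Z: "zero_object C Z" using zero_object_exists .
  then have ZO: "Z \<in> Obj C" by (simp add: zero_object_def)
  define G where "G i = (if i = 0 then M else Z)" for i :: nat
  define d where "d i = null C (G (Suc i)) (G i)" for i
  have GO: "G i \<in> Obj C" for i using M ZO by (simp add: G_def)
  have d: "d i \<in> Hom C (G (Suc i)) (G i)" for i using null_in_Hom GO by (simp add: d_def)
  have mono: "monic C h" if "h \<in> Hom C Z X" for h X
  proof (rule monicI[OF that])
    fix W u v assume "u \<in> Hom C W Z" "v \<in> Hom C W Z"
    then show "u = v" using zero_object_Hom[OF Z] by metis
  qed
  have ex: "exact_at C (d (Suc i)) (d i)" for i
    using exact_at_null_left[OF Z d[of i, unfolded G_def, simplified, folded G_def]] mono d[of i]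
    by (simp add: d_def G_def)
  have id: "ident C M \<in> Hom C (G 0) M" using ident_in_Hom[OF M] by (simp add: G_def)
  have ex0: "exact_at C (d 0) (ident C M)" "exact_at C (ident C M) (null C M Z)"
    using exact_at_null_left[OF Z ident_in_Hom[OF M]] exact_at_null_right[OF Z ident_in_Hom[OF M]]
      ident_monic[OF M] ident_epic[OF M] by (simp_all add: d_def G_def)
  have "G i \<in> \<F> \<or> zero_object C (G i)" "\<alpha> < enat i \<longrightarrow> zero_object C (G i)" for i
    using assms Z by (auto simp: G_def zero_enat_def[symmetric])
  then show ?thesis unfolding resolved_by_def using M d id Z ex ex0 by blast
qed

text \<open>An object with a resolution of length zero is isomorphic to one of \<open>\<F>\<close>. That it belongs to \<open>\<F>\<close>
  is the case \<open>n = 0\<close> of the second condition, for the exact sequence \<open>0 \<rightarrow> M \<rightarrow> M \<rightarrow> 0\<close>.\<close>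

lemma resolved_by_0: "resolved_by C \<F> (enat 0) = \<F>"
proof
  show "\<F> \<subseteq> resolved_by C \<F> (enat 0)" using \<F>_resolved_by by blast
  show "resolved_by C \<F> (enat 0) \<subseteq> \<F>"
  proof
    fix M assume M: "M \<in> resolved_by C \<F> (enat 0)"
    note O = resolved_by_Obj[OF M]
    have "length [ident C M] = Suc 0 \<and> exact_between_zeros C [ident C M] \<and>
        (\<forall>f \<in> set (butlast [ident C M]). Cod C f \<in> \<F>) \<and>
        Cod C (last [ident C M]) \<in> resolved_by C \<F> (enat 0)"
      using exact_between_zeros_ident[OF O] M HomD[OF ident_in_Hom[OF O]] by simp
    then have "Dom C (hd [ident C M]) \<in> \<F>"
      using dimension unfolding defines_homological_dimension_def by blast
    then show "M \<in> \<F>" using HomD[OF ident_in_Hom[OF O]] by simp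
  qed
qed

lemma extension_resolved_by:
  assumes "extension C K P M" "P \<in> \<F>" "K \<in> resolved_by C \<F> (enat n)"
  shows "M \<in> resolved_by C \<F> (enat (Suc n))"
proof -
  obtain k p where k: "k \<in> Hom C K P" and p: "p \<in> Hom C P M" and ker: "is_kernel C k p" and "epic C p"
    using assms(1) unfolding extension_def by blast
  obtain G d e Z where d: "\<And>i. d i \<in> Hom C (G (Suc i)) (G i)" and e: "e \<in> Hom C (G 0) K"
    and Z: "zero_object C Z" and ex: "\<And>i. exact_at C (d (Suc i)) (d i)" and ex0: "exact_at C (d 0) e"
    and "exact_at C e (null C K Z)" and G: "\<And>i. G i \<in> \<F> \<or> zero_object C (G i)"
    and zero: "\<And>i. enat i > enat n \<longrightarrow> zero_object C (G i)"
    using assms(3) unfolding resolved_by_def by blast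
  have "epic C e" using exact_at_null_right[OF Z e] \<open>exact_at C e (null C K Z)\<close> by simp
  define G' where "G' i = (case i of 0 \<Rightarrow> P | Suc j \<Rightarrow> G j)" for i
  define d' where "d' i = (case i of 0 \<Rightarrow> k \<cdot> e | Suc j \<Rightarrow> d j)" for i
  have "exact_at C k p" using monic_exact_at_iff_kernel[OF is_kernel_monic[OF ker] k p] ker by simp
  then have kep: "exact_at C (k \<cdot> e) p"
    using exact_at_cmp_epic[OF _ \<open>epic C e\<close>] e HomD[OF k] by simp
  have dke: "exact_at C (d 0) (k \<cdot> e)"
    using exact_at_monic_cmp[OF ex0 is_kernel_monic[OF ker]] k HomD[OF e] by simp
  have "\<forall>i. d' i \<in> Hom C (G' (Suc i)) (G' i)"
    using d cmp_in_Hom[OF e k] by (auto simp: d'_def G'_def split: nat.split)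
  moreover have "\<forall>i. exact_at C (d' (Suc i)) (d' i)"
    using ex dke by (auto simp: d'_def split: nat.split)
  moreover have "exact_at C (d' 0) p" "p \<in> Hom C (G' 0) M"
    using kep p by (simp_all add: d'_def G'_def)
  moreover have "exact_at C p (null C M Z)" using exact_at_null_right[OF Z p] \<open>epic C p\<close> by simp
  moreover have "\<forall>i. G' i \<in> \<F> \<or> zero_object C (G' i)"
    using G assms(2) by (auto simp: G'_def split: nat.split)
  moreover have "\<forall>i. enat (Suc n) < enat i \<longrightarrow> zero_object C (G' i)"
    using zero by (auto simp: G'_def split: nat.split)
  ultimately show ?thesis
    unfolding resolved_by_def using Hom_objects(2)[OF p] Z by blast
qed

lemma extension_resolved_by_infinity:
  assumes "extension C K P M" "P \<in> \<F>" "M \<in> resolved_by C \<F> \<infinity>"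
  shows "K \<in> resolved_by C \<F> \<infinity>"
proof -
  obtain k p where k: "k \<in> Hom C K P" and p: "p \<in> Hom C P M" and se: "short_exact C k p"
    using extension_short_exact[OF assms(1)] .
  then have "short_exact C k p \<and> Cod C k \<in> \<F> \<and> Cod C p \<in> resolved_by C \<F> \<infinity>"
    using assms(2,3) HomD[OF k] HomD[OF p] by simp
  then have "Dom C k \<in> resolved_by C \<F> \<infinity>"
    using dimension unfolding defines_homological_dimension_def by blast
  then show ?thesis using HomD[OF k] by simp
qed

text \<open>Here \<open>fs\<close> is a partial resolution of length \<open>m\<close> of its last object, and the object in question is
  its kernel. The induction lengthens the partial resolution by one step, which decreases \<open>n\<close>, until \<open>n = 0\<close>
  and the second condition on \<open>\<F>\<close> applies. The next cover by an object of \<open>\<F>\<close> exists because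
  the first condition keeps the kernels in \<open>\<F>\<^sub>\<infinity>\<close>.\<close>

lemma partial_resolution_kernel:
  assumes "exact_between_zeros C fs" "length fs = Suc m" "\<forall>f \<in> set (butlast fs). Cod C f \<in> \<F>"
    and "Cod C (last fs) \<in> resolved_by C \<F> (enat (m + n))"
    and "Dom C (hd fs) \<in> resolved_by C \<F> \<infinity>"
  shows "Dom C (hd fs) \<in> resolved_by C \<F> (enat n)"
  using assms
proof (induction n arbitrary: fs m)
  case 0
  then have "Dom C (hd fs) \<in> \<F>"
    using dimension unfolding defines_homological_dimension_def by auto
  then show ?case by (rule \<F>_resolved_by)
next
  case (Suc n)
  obtain h t where fs: "fs = h # t" using Suc.prems(2) by (cases fs) auto
  let ?K = "Dom C h"
  have h: "h \<in> Hom C ?K (Cod C h)" using exact_between_zeros_hd Suc.prems(1) fs by simp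
  have K: "?K \<in> resolved_by C \<F> \<infinity>" using Suc.prems(5) fs by simp
  obtain P q where P: "P \<in> \<F>" "q \<in> Hom C P ?K" "epic C q" using resolved_by_cover[OF K] .
  obtain K' where K': "extension C K' P ?K" using extension_of_epic[OF P(3,2)] .
  obtain k p where k: "k \<in> Hom C K' P" and p: "p \<in> Hom C P ?K" and ker: "is_kernel C k p" and "epic C p"
    using K' unfolding extension_def by blast
  let ?fs = "k # (h \<cdot> p) # t"
  have hp: "h \<cdot> p \<in> Hom C P (Cod C h)" using cmp_in_Hom[OF p h] .
  have "Dom C (hd ?fs) \<in> resolved_by C \<F> (enat n)"
  proof (rule Suc.IH)
    show "exact_between_zeros C ?fs"
      using exact_between_zeros_splice[OF _ h k p ker \<open>epic C p\<close>] Suc.prems(1) fs by simp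
    show "length ?fs = Suc (Suc m)" using Suc.prems(2) fs by simp
    show "\<forall>f \<in> set (butlast ?fs). Cod C f \<in> \<F>"
      using Suc.prems(3) fs HomD[OF k] HomD[OF hp] P(1) by (auto split: if_splits)
    show "Cod C (last ?fs) \<in> resolved_by C \<F> (enat (Suc m + n))"
      using Suc.prems(4) fs HomD[OF hp] by (auto split: if_splits)
    show "Dom C (hd ?fs) \<in> resolved_by C \<F> \<infinity>"
      using extension_resolved_by_infinity[OF K' P(1) K] HomD[OF k] by simp
  qed
  then have "K' \<in> resolved_by C \<F> (enat n)" using HomD[OF k] by simp
  then show ?case using extension_resolved_by[OF K' P(1)] fs by simp
qed

lemma syzygy_resolved_by:
  assumes "extension C K P M" "P \<in> \<F>" "M \<in> resolved_by C \<F> (enat (Suc n))"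
  shows "K \<in> resolved_by C \<F> (enat n)"
proof -
  have "M \<in> resolved_by C \<F> \<infinity>" using assms(3) resolved_by_mono[of "enat (Suc n)" \<infinity>] by auto
  then have inf: "K \<in> resolved_by C \<F> \<infinity>" using extension_resolved_by_infinity assms(1,2) by blast
  obtain k p where k: "k \<in> Hom C K P" and p: "p \<in> Hom C P M" and se: "short_exact C k p"
    using extension_short_exact[OF assms(1)] .
  then show ?thesis
    using partial_resolution_kernel[of "[k, p]" 1 n] inf assms(2,3) HomD[OF k] HomD[OF p]
    by (simp add: short_exact_def)
qed

lemma resolved_by_Suc: "M \<in> resolved_by C \<F> (enat n) \<Longrightarrow> M \<in> resolved_by C \<F> (enat (Suc n))"
  using resolved_by_mono[of "enat n" "enat (Suc n)"] by auto

section \<open>The four statements\<close>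

text \<open>Induction applies to the sequence of \<open>extension_mapping_cone\<close> because its first two terms are
  syzygies of \<open>X\<close> and \<open>Y\<close>; its last term is a syzygy of \<open>Z\<close>.\<close>

lemma resolved_by_quotient:
  assumes "extension C X Y Z" "X \<in> resolved_by C \<F> (enat n)" "Y \<in> resolved_by C \<F> (enat n)"
  shows "Z \<in> resolved_by C \<F> (enat (Suc n))"
  using assms
proof (induction n arbitrary: X Y Z)
  case 0
  then show ?case using extension_resolved_by[of X Y Z 0] resolved_by_0 by simp
next
  case (Suc n)
  obtain P p where P: "P \<in> \<F>" "p \<in> Hom C P Y" "epic C p" using resolved_by_cover[OF Suc.prems(3)] .
  obtain Q q where Q: "Q \<in> \<F>" "q \<in> Hom C Q X" "epic C q" using resolved_by_cover[OF Suc.prems(2)] .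
  obtain K L R S where KQ: "extension C K Q X" and L: "extension C L P Z" and R: "extension C R S Y"
    and K: "extension C K R L"
    and S: "\<And>\<F>. closed_under_finite_direct_sums C \<F> \<Longrightarrow> P \<in> \<F> \<Longrightarrow> Q \<in> \<F> \<Longrightarrow> S \<in> \<F>"
    using extension_mapping_cone[OF Suc.prems(1) P(3,2) Q(3,2)] by blast
  have "S \<in> \<F>" using S sums P(1) Q(1) by blast
  then have "R \<in> resolved_by C \<F> (enat n)" using syzygy_resolved_by R Suc.prems(3) by blast
  moreover have "K \<in> resolved_by C \<F> (enat n)" using syzygy_resolved_by KQ Q(1) Suc.prems(2) by blast
  ultimately have "L \<in> resolved_by C \<F> (enat (Suc n))" using Suc.IH K by blast
  then show ?case using extension_resolved_by L P(1) by blast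
qed

text \<open>The sequence of \<open>extension_pullback\<close> bounds the dimension of \<open>X\<close> up to an error of one, by
  \<open>resolved_by_quotient\<close>. The induction hypothesis for the sequence of \<open>extension_mapping_cone\<close>, in which the
  kernel is a syzygy of \<open>X\<close>, removes the error.\<close>

lemma resolved_by_kernel:
  assumes "extension C X Y Z" "Y \<in> resolved_by C \<F> (enat n)" "Z \<in> resolved_by C \<F> (enat (Suc n))"
  shows "X \<in> resolved_by C \<F> (enat n)"
  using assms
proof (induction n arbitrary: X Y Z)
  case 0
  then show ?case using syzygy_resolved_by[of X Y Z 0] resolved_by_0 by simp
next
  case (Suc n)
  obtain P p where P: "P \<in> \<F>" "p \<in> Hom C P Y" "epic C p" using resolved_by_cover[OF Suc.prems(2)] .
  obtain K L where K: "extension C K P Y" and L: "extension C L P Z" and KL: "extension C K L X"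
    using extension_pullback[OF Suc.prems(1) P(3,2)] .
  have "K \<in> resolved_by C \<F> (enat n)" using syzygy_resolved_by K P(1) Suc.prems(2) by blast
  moreover have "L \<in> resolved_by C \<F> (enat (Suc n))" using syzygy_resolved_by L P(1) Suc.prems(3) by blast
  \<comment> \<open>This bound is one too large; it serves to cover \<open>X\<close> by an object of \<open>\<F>\<close>.\<close>
  ultimately have X: "X \<in> resolved_by C \<F> (enat (Suc (Suc n)))"
    using resolved_by_quotient KL resolved_by_Suc by blast
  obtain Q q where Q: "Q \<in> \<F>" "q \<in> Hom C Q X" "epic C q" using resolved_by_cover[OF X] .
  obtain K' L' R S where K'Q: "extension C K' Q X" and L': "extension C L' P Z"
    and R: "extension C R S Y" and K': "extension C K' R L'"
    and S: "\<And>\<F>. closed_under_finite_direct_sums C \<F> \<Longrightarrow> P \<in> \<F> \<Longrightarrow> Q \<in> \<F> \<Longrightarrow> S \<in> \<F>"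
    using extension_mapping_cone[OF Suc.prems(1) P(3,2) Q(3,2)] by blast
  have "S \<in> \<F>" using S sums P(1) Q(1) by blast
  then have "R \<in> resolved_by C \<F> (enat n)" using syzygy_resolved_by R Suc.prems(2) by blast
  moreover have "L' \<in> resolved_by C \<F> (enat (Suc n))" using syzygy_resolved_by L' P(1) Suc.prems(3) by blast
  ultimately have "K' \<in> resolved_by C \<F> (enat n)" using Suc.IH K' by blast
  then show ?case using extension_resolved_by K'Q Q(1) by blast
qed

text \<open>Closure of the quotients of \<open>\<F>\<close> under extensions supplies the first step \<open>P\<close> of a resolution of
  \<open>Y\<close>; the dimension of the syzygy is then controlled by \<open>resolved_by_kernel\<close>.\<close>

lemma resolved_by_extension:
  assumes "closed_under_extensions C (quotients_of C \<F>)" and ext: "extension C X Y Z"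
    and X: "X \<in> resolved_by C \<F> (enat (Suc n))" and Z: "Z \<in> resolved_by C \<F> (enat (Suc n))"
  shows "Y \<in> resolved_by C \<F> (enat (Suc n))"
proof -
  have quot: "M \<in> quotients_of C \<F>" if "M \<in> resolved_by C \<F> \<alpha>" for M \<alpha>
    using resolved_by_cover[OF that] resolved_by_Obj[OF that] unfolding quotients_of_def by blast
  obtain f g where f: "f \<in> Hom C X Y" and g: "g \<in> Hom C Y Z" and "short_exact C f g"
    using extension_short_exact[OF ext] .
  then have "short_exact C f g \<and> Dom C f \<in> quotients_of C \<F> \<and> Cod C g \<in> quotients_of C \<F>"
    using quot[OF X] quot[OF Z] HomD[OF f] HomD[OF g] by simp
  then have "Cod C f \<in> quotients_of C \<F>" using assms(1) unfolding closed_under_extensions_def by blast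
  then have "Y \<in> quotients_of C \<F>" using HomD[OF f] by simp
  then obtain P p where P: "P \<in> \<F>" "p \<in> Hom C P Y" "epic C p" unfolding quotients_of_def by blast
  obtain K L where K: "extension C K P Y" and L: "extension C L P Z" and KL: "extension C K L X"
    using extension_pullback[OF ext P(3,2)] .
  have "L \<in> resolved_by C \<F> (enat n)" using syzygy_resolved_by L P(1) Z by blast
  then have "K \<in> resolved_by C \<F> (enat n)" using resolved_by_kernel KL X by blast
  then show ?thesis using extension_resolved_by K P(1) by blast
qed

end

theorem theorem1p10:
  fixes \<A> :: "('o, 'm) cat" and \<F> :: "'o set" and A B C :: 'o and f g :: 'm
  assumes "abelian_category \<A>"
    and "\<F> \<subseteq> Obj \<A>"
    and "defines_homological_dimension \<A> \<F>"
    and "closed_under_finite_direct_sums \<A> \<F>"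
    and "f \<in> Hom \<A> A B" and "g \<in> Hom \<A> B C" and "short_exact \<A> f g"
  shows "(\<forall>i::nat.
        (B \<in> resolved_by \<A> \<F> (enat i) \<and> C \<in> resolved_by \<A> \<F> (enat i)
           \<longrightarrow> A \<in> resolved_by \<A> \<F> (enat i)) \<and>
        (A \<in> resolved_by \<A> \<F> (enat i) \<and> B \<in> resolved_by \<A> \<F> (enat i)
           \<longrightarrow> C \<in> resolved_by \<A> \<F> (enat (i + 1)))) \<and>
    (closed_under_extensions \<A> (quotients_of \<A> \<F>) \<longrightarrow>
      (\<forall>i::nat.
        (A \<in> resolved_by \<A> \<F> (enat (i + 1)) \<and> C \<in> resolved_by \<A> \<F> (enat (i + 1))
           \<longrightarrow> B \<in> resolved_by \<A> \<F> (enat (i + 1))) \<and>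
        (B \<in> resolved_by \<A> \<F> (enat i) \<and> C \<in> resolved_by \<A> \<F> (enat (i + 1))
           \<longrightarrow> A \<in> resolved_by \<A> \<F> (enat i))))"
proof -
  interpret homological_dimension \<A> \<F>
    using assms(1-4) by (simp add: homological_dimension_def homological_dimension_axioms_def)
  have ext: "extension \<A> A B C"
    using assms(5-7) short_exact_iff unfolding extension_def by blast
  show ?thesis
    using resolved_by_kernel[OF ext] resolved_by_quotient[OF ext] resolved_by_extension[OF _ ext]
      resolved_by_Suc by simp
qed

end
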